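(* Let $X,Y$ be smooth manifolds, let $u=\mathrm{cl}[(u_\varepsilon)_\varepsilon]\in\mathcal G[X,Y]$ and let $\tilde p=\mathrm{cl}[(p_\varepsilon)_\varepsilon]\in\widetilde X_c$. Then $u(\tilde p):=\mathrm{cl}[(u_\varepsilon(p_\varepsilon))_\varepsilon]$ is a well-defined element of $\widetilde Y_c$. (That is, $(u_\varepsilon(p_\varepsilon))_\varepsilon$ is compactly supported in $Y$, and its class in $\widetilde Y_c$ depends neither on the representative $(u_\varepsilon)_\varepsilon$ of $u$ nor on the representative $(p_\varepsilon)_\varepsilon$ of $\tilde p$.)
   Context: Manifolds are smooth, paracompact, Hausdorff and finite-dimensional. $I=(0,1]$, $\mathbb N=\{1,2,\dots\}$, $\mathbb N_0=\mathbb N\cup\{0\}$; $O(\cdot)$ refers to $\varepsilon\to0$. $K\subset\subset X$ means that $K$ is a compact subset of $X$. A supremum over the empty set is $0$. $D^{(k)}$ is the total derivative of order $k$ and $\|\cdot\|$ is any norm on the respective space of multilinear maps. $d_h$ is the distance function induced by a Riemannian metric $h$, with $d_h(p,q)=\infty$ if $p,q$ lie in different connected components. $\mathcal E_M[X,Y]$ is the set of all nets $(u_\varepsilon)_\varepsilon\in C^\infty(X,Y)^I$ such that: (i) $\forall K\subset\subset X\ \exists\varepsilon_0>0\ \exists K'\subset\subset Y\ \forall\varepsilon<\varepsilon_0:\ u_\varepsilon(K)\subseteq K'$; (ii) for all $k\in\mathbb N$, each chart $(V,\varphi)$ in $X$, each chart $(W,\psi)$ in $Y$, each $L\subset\subset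 V$ and each $L'\subset\subset W$ there is $N\in\mathbb N$ with $\sup_{p\in L\cap u_\varepsilon^{-1}(L')}\|D^{(k)}(\psi\circ u_\varepsilon\circ\varphi^{-1})(\varphi(p))\|=O(\varepsilon^{-N})$. Two elements $(u_\varepsilon)_\varepsilon,(v_\varepsilon)_\varepsilon$ of $\mathcal E_M[X,Y]$ are equivalent, $(u_\varepsilon)_\varepsilon\sim(v_\varepsilon)_\varepsilon$, if: (i) for all $K\subset\subset X$, $\sup_{p\in K}d_h(u_\varepsilon(p),v_\varepsilon(p))\to0$ as $\varepsilon\to0$ for some (hence every) Riemannian metric $h$ on $Y$; (ii) for all $k\in\mathbb N_0$, $m\in\mathbb N$, charts $(V,\varphi)$ in $X$, $(W,\psi)$ in $Y$, $L\subset\subset V$, $L'\subset\subset W$: $\sup_{p\in L\cap u_\varepsilon^{-1}(L')\cap v_\varepsilon^{-1}(L')}\|D^{(k)}(\psi\circ u_\varepsilon\circ\varphi^{-1}-\psi\circ v_\varepsilon\circ\varphi^{-1})(\varphi(p))\|=O(\varepsilon^m)$. $\mathcal G[X,Y]:=\mathcal E_M[X,Y]/\!\sim$; the class of $(u_\varepsilon)_\varepsilon$ is written $\mathrm{cl}[(u_\varepsilon)_\varepsilon]$. A net $(p_\varepsilon)_\varepsilon\in X^I$ is compactly supported if there are $K\subset\subset X$ and $\varepsilon_0>0$ with $p_\varepsilon\in K$ for $\varepsilon<\varepsilon_0$. Compactly supported nets $(p_\varepsilon)_\varepsilon,(q_\varepsilon)_\varepsilon$ are equivalent, $(p_\varepsilon)_\varepsilon\sim(q_\varepsilon)_\varepsilon$,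 if $d_h(p_\varepsilon,q_\varepsilon)=O(\varepsilon^m)$ for each $m>0$, for one (equivalently every) Riemannian metric $h$ on $X$. The quotient is $\widetilde X_c$, with elements $\tilde p=\mathrm{cl}[(p_\varepsilon)_\varepsilon]$; $\widetilde Y_c$ is defined likewise. *)

theory Defs
  imports "HOL-Analysis.Analysis"
begin

section \<open>Total derivatives of arbitrary order\<close>

text \<open>
  \<open>total_deriv f [v\<^sub>1, \<dots>, v\<^sub>k] x\<close> is \<open>D\<^sup>(\<^sup>k\<^sup>)f(x)(v\<^sub>1, \<dots>, v\<^sub>k)\<close>; a list of directions replaces the
  type of \<open>k\<close>-linear maps, which would depend on \<open>k\<close>. At a point \<open>x\<close> the value depends
  only on the germ of \<open>f\<close> at \<open>x\<close>, so \<open>f\<close> may be arbitrary away from \<open>x\<close>.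
\<close>

primrec total_deriv ::
  "('e::real_normed_vector \<Rightarrow> 'f::real_normed_vector) \<Rightarrow> 'e list \<Rightarrow> 'e \<Rightarrow> 'f" where
  "total_deriv f [] = f"
| "total_deriv f (v # vs) = (\<lambda>x. frechet_derivative (total_deriv f vs) (at x) v)"

text \<open>Operator norm of the \<open>k\<close>-linear map \<open>D\<^sup>(\<^sup>k\<^sup>)f(x)\<close>; for \<open>k = 0\<close> it is the norm of \<open>f x\<close>.\<close>

definition total_deriv_norm ::
  "nat \<Rightarrow> ('e::real_normed_vector \<Rightarrow> 'f::real_normed_vector) \<Rightarrow> 'e \<Rightarrow> ennreal" where
  "total_deriv_norm k f x =
     (SUP vs\<in>{vs. length vs = k \<and> (\<forall>v\<in>set vs. norm v \<le> 1)}. ennreal (norm (total_deriv f vs x)))"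

text \<open>
  Smoothness on an open subset of a finite-dimensional space. In finite dimensions
  \<open>D\<^sup>(\<^sup>k\<^sup>)f\<close> is differentiable iff all of its evaluations at fixed directions are.
\<close>

definition smooth_on ::
  "'e::real_normed_vector set \<Rightarrow> ('e \<Rightarrow> 'f::real_normed_vector) \<Rightarrow> bool" where
  "smooth_on S f \<longleftrightarrow> (\<forall>vs. \<forall>x\<in>S. total_deriv f vs differentiable (at x))"


section \<open>Smooth manifolds\<close>

text \<open>
  The underlying topological space is the whole type \<open>'a\<close>. A chart is a pair \<open>(V, \<phi>)\<close>; the
  values of \<open>\<phi>\<close> outside \<open>V\<close> are irrelevant. The model space \<open>'e\<close> is a finite-dimensional
  inner product space; class \<open>euclidean_space\<close> is not used because it
  excludes dimension \<open>0\<close>.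
\<close>

type_synonym ('a, 'e) chart = "'a set \<times> ('a \<Rightarrow> 'e)"
type_synonym ('a, 'e) atlas = "('a, 'e) chart set"

definition topological_chart :: "('a::topological_space, 'e::real_inner) chart \<Rightarrow> bool" where
  "topological_chart = (\<lambda>(V, \<phi>). open V \<and> open (\<phi> ` V) \<and> homeomorphism V (\<phi> ` V) \<phi> (inv_into V \<phi>))"

definition compatible :: "('a, 'e::real_inner) chart \<Rightarrow> ('a, 'e) chart \<Rightarrow> bool" where
  "compatible = (\<lambda>(V, \<phi>) (W, \<psi>).
     smooth_on (\<phi> ` (V \<inter> W)) (\<psi> \<circ> inv_into V \<phi>) \<and> smooth_on (\<psi> ` (V \<inter> W)) (\<phi> \<circ> inv_into W \<psi>))"

definition paracompact :: "'a::topological_space itself \<Rightarrow> bool" where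
  "paracompact _ \<longleftrightarrow>
     (\<forall>\<C>::'a set set. (\<forall>C\<in>\<C>. open C) \<and> \<Union>\<C> = UNIV \<longrightarrow>
        (\<exists>\<D>. (\<forall>D\<in>\<D>. open D \<and> (\<exists>C\<in>\<C>. D \<subseteq> C)) \<and> \<Union>\<D> = UNIV \<and> locally_finite_in euclidean \<D>))"

text \<open>
  A smooth structure is a maximal atlas, so that its elements are all the charts of the manifold.
  The Hausdorff property is the class constraint \<open>t2_space\<close>.
\<close>

definition smooth_manifold :: "('a::t2_space, 'e::real_inner) atlas \<Rightarrow> bool" where
  "smooth_manifold A \<longleftrightarrow>
     (\<exists>B::'e set. finite B \<and> span B = UNIV) \<and>
     paracompact TYPE('a) \<and>
     (\<forall>c\<in>A. topological_chart c) \<and> \<Union>(fst ` A) = UNIV \<and>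
     (\<forall>c\<in>A. \<forall>d\<in>A. compatible c d) \<and>
     (\<forall>c. topological_chart c \<and> (\<forall>d\<in>A. compatible c d) \<longrightarrow> c \<in> A)"

definition smooth_map ::
  "('a::t2_space, 'e::real_inner) atlas \<Rightarrow> ('b::t2_space, 'f::real_inner) atlas \<Rightarrow> ('a \<Rightarrow> 'b) \<Rightarrow> bool" where
  "smooth_map A B u \<longleftrightarrow>
     continuous_on UNIV u \<and>
     (\<forall>(V, \<phi>)\<in>A. \<forall>(W, \<psi>)\<in>B. smooth_on (\<phi> ` (V \<inter> u -` W)) (\<psi> \<circ> u \<circ> inv_into V \<phi>))"


section \<open>Riemannian metrics and their distance functions\<close>

text \<open>
  A Riemannian metric is given by its components: \<open>h (V, \<phi>) p v w\<close> is the inner product of the two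
  tangent vectors at \<open>p\<close> that are represented by \<open>v\<close> and \<open>w\<close> in the chart \<open>(V, \<phi>)\<close>. The last
  condition is the transformation law of a covariant 2-tensor field.
\<close>

type_synonym ('a, 'e) metric_tensor = "('a, 'e) chart \<Rightarrow> 'a \<Rightarrow> 'e \<Rightarrow> 'e \<Rightarrow> real"

definition riemannian_metric ::
  "('a::t2_space, 'e::real_inner) atlas \<Rightarrow> ('a, 'e) metric_tensor \<Rightarrow> bool" where
  "riemannian_metric A h \<longleftrightarrow>
     (\<forall>(V, \<phi>)\<in>A. \<forall>p\<in>V.
        bilinear (h (V, \<phi>) p) \<and>
        (\<forall>v w. h (V, \<phi>) p v w = h (V, \<phi>) p w v) \<and>
        (\<forall>v. v \<noteq> 0 \<longrightarrow> h (V, \<phi>) p v v > 0)) \<and>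
     (\<forall>(V, \<phi>)\<in>A. \<forall>v w. smooth_on (\<phi> ` V) (\<lambda>x. h (V, \<phi>) (inv_into V \<phi> x) v w)) \<and>
     (\<forall>(V, \<phi>)\<in>A. \<forall>(W, \<psi>)\<in>A. \<forall>p\<in>V \<inter> W. \<forall>v w.
        (let D = frechet_derivative (\<psi> \<circ> inv_into V \<phi>) (at (\<phi> p))
         in h (V, \<phi>) p v w = h (W, \<psi>) p (D v) (D w)))"

text \<open>
  A curve is smooth on \<open>[a, b]\<close> if it extends to a smooth curve on an open neighbourhood
  of \<open>[a, b]\<close> in the real line.
\<close>

definition smooth_curve_on ::
  "('a::t2_space, 'e::real_inner) atlas \<Rightarrow> (real \<Rightarrow> 'a) \<Rightarrow> real \<Rightarrow> real \<Rightarrow> bool" where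
  "smooth_curve_on A c a b \<longleftrightarrow>
     (\<exists>\<gamma> S. open S \<and> {a..b} \<subseteq> S \<and> continuous_on S \<gamma> \<and>
        (\<forall>(V, \<phi>)\<in>A. smooth_on (S \<inter> \<gamma> -` V) (\<phi> \<circ> \<gamma>)) \<and>
        (\<forall>t\<in>{a..b}. \<gamma> t = c t))"

definition piecewise_smooth_curve ::
  "('a::t2_space, 'e::real_inner) atlas \<Rightarrow> (real \<Rightarrow> 'a) \<Rightarrow> bool" where
  "piecewise_smooth_curve A c \<longleftrightarrow>
     (\<exists>(n::nat) t::nat \<Rightarrow> real. t 0 = 0 \<and> t n = 1 \<and>
        (\<forall>i<n. t i < t (Suc i) \<and> smooth_curve_on A c (t i) (t (Suc i))))"

text \<open>
  The length of the velocity of \<open>c\<close> at time \<open>t\<close>, computed in any chart around \<open>c t\<close>. At the finitely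
  many break points of a piecewise smooth curve the value is unspecified, which does not affect
  the integral.
\<close>

definition curve_speed ::
  "('a::t2_space, 'e::real_inner) atlas \<Rightarrow> ('a, 'e) metric_tensor \<Rightarrow> (real \<Rightarrow> 'a) \<Rightarrow> real \<Rightarrow> real" where
  "curve_speed A h c t =
     (THE s. \<exists>(V, \<phi>)\<in>A. c t \<in> V \<and>
        (let v = vector_derivative (\<phi> \<circ> c) (at t) in s = sqrt (h (V, \<phi>) (c t) v v)))"

definition curve_length ::
  "('a::t2_space, 'e::real_inner) atlas \<Rightarrow> ('a, 'e) metric_tensor \<Rightarrow> (real \<Rightarrow> 'a) \<Rightarrow> real" where
  "curve_length A h c = integral {0..1} (curve_speed A h c)"

text \<open>The infimum over the empty set is \<open>\<infinity>\<close>, the distance of points in different components.\<close>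

definition riemannian_dist ::
  "('a::t2_space, 'e::real_inner) atlas \<Rightarrow> ('a, 'e) metric_tensor \<Rightarrow> 'a \<Rightarrow> 'a \<Rightarrow> ennreal" where
  "riemannian_dist A h p q =
     (INF c\<in>{c. piecewise_smooth_curve A c \<and> c 0 = p \<and> c 1 = q}. ennreal (curve_length A h c))"


section \<open>Generalized functions valued in a manifold\<close>

text \<open>
  Nets are functions on \<open>real\<close> of which only the restriction to \<open>(0, 1]\<close> matters. The supremum in
  \<^typ>\<open>ennreal\<close> over the empty set is \<open>0\<close>. ``For all sufficiently small \<open>\<epsilon> > 0\<close>'' is
  expressed by the filter \<open>at_right 0\<close>.
\<close>

definition bigO_eps :: "(real \<Rightarrow> ennreal) \<Rightarrow> real \<Rightarrow> bool" where
  "bigO_eps f a \<longleftrightarrow> (\<exists>C::real. \<forall>\<^sub>F \<epsilon> in at_right 0. f \<epsilon> \<le> ennreal (C * \<epsilon> powr a))"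

definition moderate_nets ::
  "('a::t2_space, 'e::real_inner) atlas \<Rightarrow> ('b::t2_space, 'f::real_inner) atlas \<Rightarrow> (real \<Rightarrow> 'a \<Rightarrow> 'b) set" where
  "moderate_nets A B = {u.
     (\<forall>\<epsilon>\<in>{0<..1}. smooth_map A B (u \<epsilon>)) \<and>
     (\<forall>K. compact K \<longrightarrow> (\<exists>K'. compact K' \<and> (\<forall>\<^sub>F \<epsilon> in at_right 0. u \<epsilon> ` K \<subseteq> K'))) \<and>
     (\<forall>k::nat. k \<ge> 1 \<longrightarrow> (\<forall>(V, \<phi>)\<in>A. \<forall>(W, \<psi>)\<in>B. \<forall>L L'.
        compact L \<and> L \<subseteq> V \<and> compact L' \<and> L' \<subseteq> W \<longrightarrow>
        (\<exists>N::nat. N \<ge> 1 \<and>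
           bigO_eps (\<lambda>\<epsilon>. SUP p\<in>L \<inter> u \<epsilon> -` L'.
             total_deriv_norm k (\<psi> \<circ> u \<epsilon> \<circ> inv_into V \<phi>) (\<phi> p)) (- real N))))}"

definition gf_rel ::
  "('a::t2_space, 'e::real_inner) atlas \<Rightarrow> ('b::t2_space, 'f::real_inner) atlas \<Rightarrow>
     ((real \<Rightarrow> 'a \<Rightarrow> 'b) \<times> (real \<Rightarrow> 'a \<Rightarrow> 'b)) set" where
  "gf_rel A B = {(u, v). u \<in> moderate_nets A B \<and> v \<in> moderate_nets A B \<and>
     (\<exists>h. riemannian_metric B h \<and>
        (\<forall>K. compact K \<longrightarrow>
           ((\<lambda>\<epsilon>. SUP p\<in>K. riemannian_dist B h (u \<epsilon> p) (v \<epsilon> p)) \<longlongrightarrow> 0) (at_right 0))) \<and>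
     (\<forall>(k::nat) m::nat. m \<ge> 1 \<longrightarrow> (\<forall>(V, \<phi>)\<in>A. \<forall>(W, \<psi>)\<in>B. \<forall>L L'.
        compact L \<and> L \<subseteq> V \<and> compact L' \<and> L' \<subseteq> W \<longrightarrow>
        bigO_eps (\<lambda>\<epsilon>. SUP p\<in>L \<inter> u \<epsilon> -` L' \<inter> v \<epsilon> -` L'.
          total_deriv_norm k
            (\<lambda>x. (\<psi> \<circ> u \<epsilon> \<circ> inv_into V \<phi>) x - (\<psi> \<circ> v \<epsilon> \<circ> inv_into V \<phi>) x) (\<phi> p)) (real m)))}"

definition gf_class ::
  "('a::t2_space, 'e::real_inner) atlas \<Rightarrow> ('b::t2_space, 'f::real_inner) atlas \<Rightarrow>
     (real \<Rightarrow> 'a \<Rightarrow> 'b) \<Rightarrow> (real \<Rightarrow> 'a \<Rightarrow> 'b) set" where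
  "gf_class A B u = gf_rel A B `` {u}"

definition generalized_functions ::
  "('a::t2_space, 'e::real_inner) atlas \<Rightarrow> ('b::t2_space, 'f::real_inner) atlas \<Rightarrow>
     (real \<Rightarrow> 'a \<Rightarrow> 'b) set set" where
  "generalized_functions A B = moderate_nets A B // gf_rel A B"


section \<open>Compactly supported generalized points\<close>

definition compactly_supported_nets :: "(real \<Rightarrow> 'a::t2_space) set" where
  "compactly_supported_nets = {p. \<exists>K. compact K \<and> (\<forall>\<^sub>F \<epsilon> in at_right 0. p \<epsilon> \<in> K)}"

definition point_rel ::
  "('a::t2_space, 'e::real_inner) atlas \<Rightarrow> ((real \<Rightarrow> 'a) \<times> (real \<Rightarrow> 'a)) set" where
  "point_rel A = {(p, q). p \<in> compactly_supported_nets \<and> q \<in> compactly_supported_nets \<and>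
     (\<exists>h. riemannian_metric A h \<and>
        (\<forall>m::real. m > 0 \<longrightarrow> bigO_eps (\<lambda>\<epsilon>. riemannian_dist A h (p \<epsilon>) (q \<epsilon>)) m))}"

definition point_class ::
  "('a::t2_space, 'e::real_inner) atlas \<Rightarrow> (real \<Rightarrow> 'a) \<Rightarrow> (real \<Rightarrow> 'a) set" where
  "point_class A p = point_rel A `` {p}"

definition generalized_points ::
  "('a::t2_space, 'e::real_inner) atlas \<Rightarrow> (real \<Rightarrow> 'a) set set" where
  "generalized_points A = compactly_supported_nets // point_rel A"

end

theory Submission
  imports Defs
begin

text \<open>
  Everything reduces to Euclidean estimates in charts. In a compact ball of a chart any
  Riemannian distance and the Euclidean distance bound each other up to constants, at least for
  nearby points (\<open>chart_distance_comparison\<close>): segments have length at most a constant times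
  the Euclidean distance, and a short curve cannot leave the ball
  (\<open>curve_trapped_in_chart_ball\<close>), so that its length bounds the displacement. As a compact
  set is covered by finitely many chart balls, two compactly supported nets are equivalent with
  respect to a given metric iff they are infinitely close in charts (\<open>infinitely_close\<close>,
  \<open>point_rel_eq\<close>). Because this notion does not involve the metric, the equivalence of nets is
  symmetric and transitive even though each instance may come with its own metric.

  Now let \<open>(U, V)\<close> be equivalent moderate nets and \<open>(P, Q)\<close> equivalent compactly supported
  nets. Condition (i) of moderateness makes \<open>U(P)\<close> and \<open>V(Q)\<close> compactly supported. The nets
  \<open>U(P)\<close> and \<open>U(Q)\<close> are infinitely close, for the derivative of \<open>U\<close> in charts grows
  at most like a power of \<open>1 / \<epsilon>\<close> while \<open>P\<close> and \<open>Q\<close> approach each other faster than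
  every power of \<open>\<epsilon>\<close>; the mean value theorem applies because the image of the segment from
  \<open>P\<close> to \<open>Q\<close> is again trapped in a chart ball (\<open>infinitely_close_moderate_image\<close>).
  The nets \<open>U(Q)\<close> and \<open>V(Q)\<close> are infinitely close by the zeroth order estimate for
  \<open>U - V\<close>, which becomes applicable when uniform convergence has brought both values into one
  chart (\<open>infinitely_close_equivalent_nets\<close>). Transitivity concludes the proof.
\<close>

section \<open>Finite-dimensional model spaces\<close>

text \<open>
  A model space is only known to be an inner product space with a finite spanning set, so
  orthogonal expansions and the compactness of closed balls are derived by hand from an
  orthogonal spanning set \<open>C\<close>, which may contain \<open>0\<close>: that vector contributes
  \<open>0\<close> because \<open>x / 0 = 0\<close>.
\<close>

lemma orthogonal_expansion:
  fixes C :: "'e::real_inner set"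
  assumes "finite C" "pairwise orthogonal C" "span C = UNIV"
  shows "v = (\<Sum>b\<in>C. (v \<bullet> b / (b \<bullet> b)) *\<^sub>R b)"
proof -
  define w where "w = v - (\<Sum>b\<in>C. (v \<bullet> b / (b \<bullet> b)) *\<^sub>R b)"
  have "orthogonal w c" if c: "c \<in> C" for c
  proof -
    have "(\<Sum>b\<in>C. (v \<bullet> b / (b \<bullet> b)) * (b \<bullet> c)) = (\<Sum>b\<in>C. if b = c then v \<bullet> c else 0)"
    proof (rule sum.cong)
      fix b assume "b \<in> C"
      then show "(v \<bullet> b / (b \<bullet> b)) * (b \<bullet> c) = (if b = c then v \<bullet> c else 0)"
        using assms(2) c by (cases "b = c") (auto simp: pairwise_def orthogonal_def)
    qed simp
    also have "\<dots> = v \<bullet> c"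
      using assms(1) c by simp
    finally show ?thesis
      by (simp add: w_def orthogonal_def inner_diff_left inner_sum_left)
  qed
  then have "orthogonal w w"
    using orthogonal_to_span[of w C w] assms(3) by auto
  then have "w = 0"
    by (simp add: orthogonal_def)
  then show ?thesis
    by (simp add: w_def)
qed

lemma compact_coefficient_box:
  fixes C :: "'e::real_normed_vector set"
  assumes "finite C"
  shows "compact {\<Sum>b\<in>C. f b *\<^sub>R b | f. \<forall>b\<in>C. \<bar>f b\<bar> \<le> (M b :: real)}"
  using assms
proof (induction C rule: finite_induct)
  case empty
  then show ?case by simp
next
  case (insert c C)
  let ?S = "\<lambda>C. {\<Sum>b\<in>C. f b *\<^sub>R b | f. \<forall>b\<in>C. \<bar>f b\<bar> \<le> M b}"
  let ?T = "(\<lambda>t. t *\<^sub>R c) ` {- M c..M c}"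
  have "compact ?T"
    by (intro compact_continuous_image continuous_intros) auto
  then have "compact {x + y |x y. x \<in> ?T \<and> y \<in> ?S C}"
    using insert.IH by (rule compact_sums)
  moreover have "{x + y |x y. x \<in> ?T \<and> y \<in> ?S C} = ?S (insert c C)"
  proof (intro equalityI subsetI)
    fix z assume "z \<in> {x + y |x y. x \<in> ?T \<and> y \<in> ?S C}"
    then obtain t f where *: "z = t *\<^sub>R c + (\<Sum>b\<in>C. f b *\<^sub>R b)" "\<bar>t\<bar> \<le> M c" "\<forall>b\<in>C. \<bar>f b\<bar> \<le> M b"
      by (force simp: abs_le_iff)
    have "(\<Sum>b\<in>C. (f(c := t)) b *\<^sub>R b) = (\<Sum>b\<in>C. f b *\<^sub>R b)"
      using insert.hyps by (intro sum.cong) auto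
    then have "z = (\<Sum>b\<in>insert c C. (f(c := t)) b *\<^sub>R b)"
      using insert.hyps * by simp
    moreover have "\<forall>b\<in>insert c C. \<bar>(f(c := t)) b\<bar> \<le> M b"
      using * by auto
    ultimately show "z \<in> ?S (insert c C)"
      by blast
  next
    fix z assume "z \<in> ?S (insert c C)"
    then obtain f where *: "z = (\<Sum>b\<in>insert c C. f b *\<^sub>R b)" "\<forall>b\<in>insert c C. \<bar>f b\<bar> \<le> M b"
      by auto
    have "z = f c *\<^sub>R c + (\<Sum>b\<in>C. f b *\<^sub>R b)"
      using * insert.hyps by simp
    moreover have "f c *\<^sub>R c \<in> ?T"
      using * by (intro imageI) (auto simp: abs_le_iff)
    moreover have "(\<Sum>b\<in>C. f b *\<^sub>R b) \<in> ?S C"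
      using * by auto
    ultimately show "z \<in> {x + y |x y. x \<in> ?T \<and> y \<in> ?S C}"
      by blast
  qed
  ultimately show ?case by simp
qed

lemma orthogonal_spanning_set:
  assumes "\<exists>B::'e::real_inner set. finite B \<and> span B = UNIV"
  obtains C :: "'e::real_inner set" where "finite C" "pairwise orthogonal C" "span C = UNIV"
  using assms basis_orthogonal by metis

text \<open>
  By the Cauchy-Schwarz inequality the coefficients of the vectors in a ball are bounded, so the ball
  is a closed subset of a compact coefficient box.
\<close>

lemma compact_cball_finite_span:
  fixes x :: "'e::real_inner"
  assumes "\<exists>B::'e set. finite B \<and> span B = UNIV"
  shows "compact (cball x r)"
proof -
  obtain C :: "'e set" where C: "finite C" "pairwise orthogonal C" "span C = UNIV"
    using orthogonal_spanning_set[OF assms] .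
  let ?M = "\<lambda>b. (norm x + r) * norm b / (b \<bullet> b)"
  have "cball x r \<subseteq> {\<Sum>b\<in>C. f b *\<^sub>R b | f. \<forall>b\<in>C. \<bar>f b\<bar> \<le> ?M b}"
  proof
    fix v assume "v \<in> cball x r"
    then have "norm v \<le> norm x + r"
      using norm_triangle_sub[of v x] by (simp add: dist_norm norm_minus_commute)
    then have "\<bar>v \<bullet> b / (b \<bullet> b)\<bar> \<le> ?M b" for b
      by (auto simp: abs_divide intro!: divide_right_mono
          order_trans[OF Cauchy_Schwarz_ineq2] mult_right_mono)
    then show "v \<in> {\<Sum>b\<in>C. f b *\<^sub>R b | f. \<forall>b\<in>C. \<bar>f b\<bar> \<le> ?M b}"
      using orthogonal_expansion[OF C, of v]
      by (intro CollectI exI[of _ "\<lambda>b. v \<bullet> b / (b \<bullet> b)"]) simp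
  qed
  then have "{\<Sum>b\<in>C. f b *\<^sub>R b | f. \<forall>b\<in>C. \<bar>f b\<bar> \<le> ?M b} \<inter> cball x r = cball x r"
    by blast
  moreover have "compact ({\<Sum>b\<in>C. f b *\<^sub>R b | f. \<forall>b\<in>C. \<bar>f b\<bar> \<le> ?M b} \<inter> cball x r)"
    by (intro compact_Int_closed compact_coefficient_box C(1) closed_cball)
  ultimately show ?thesis
    by simp
qed

text \<open>
  Smoothness of a metric is given for each fixed pair of tangent vectors. Expanding both arguments
  in an orthogonal spanning set turns this into joint continuity in the point and the vector, which
  is needed for compactness arguments and for the continuity of the speed of a curve.
\<close>

lemma continuous_on_quadratic_family:
  fixes g :: "'x::topological_space \<Rightarrow> 'e::real_inner \<Rightarrow> 'e \<Rightarrow> real"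
  assumes fd: "\<exists>B::'e set. finite B \<and> span B = UNIV"
    and bil: "\<And>x. x \<in> S \<Longrightarrow> bilinear (g x)"
    and cont: "\<And>v w. continuous_on S (\<lambda>x. g x v w)"
  shows "continuous_on (S \<times> UNIV) (\<lambda>(x, v). g x v v)"
proof -
  obtain C :: "'e set" where C: "finite C" "pairwise orthogonal C" "span C = UNIV"
    using orthogonal_spanning_set[OF fd] .
  let ?k = "\<lambda>v b. v \<bullet> b / (b \<bullet> b)"
  have eq: "g x v v = (\<Sum>(a, b)\<in>C \<times> C. ?k v a * ?k v b * g x a b)" if x: "x \<in> S" for x v
  proof -
    have "g x v v = g x (\<Sum>b\<in>C. ?k v b *\<^sub>R b) (\<Sum>b\<in>C. ?k v b *\<^sub>R b)"
      using orthogonal_expansion[OF C, of v] by simp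
    also have "\<dots> = (\<Sum>(a, b)\<in>C \<times> C. ?k v a * ?k v b * g x a b)"
      unfolding bilinear_sum[OF bil[OF x]]
      using bil[OF x] by (intro sum.cong) (auto simp: bilinear_lmul bilinear_rmul)
    finally show ?thesis .
  qed
  have c: "continuous_on (S \<times> UNIV) (\<lambda>z. g (fst z) a b)" for a b :: 'e
    by (rule continuous_on_compose2[OF cont continuous_on_fst[OF continuous_on_id]]) auto
  have "continuous_on (S \<times> UNIV)
          (\<lambda>z. \<Sum>(a, b)\<in>C \<times> C. ?k (snd z) a * ?k (snd z) b * g (fst z) a b)"
    unfolding case_prod_beta divide_inverse by (intro continuous_intros c)
  then show ?thesis
    by (rule continuous_on_eq) (auto simp: eq)
qed

text \<open>
  The square root of the form and its reciprocal are continuous, hence bounded, on the compact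
  product of \<open>S\<close> and the unit sphere; homogeneity carries the bounds over to all vectors. Bounds,
  unlike extrema, also make sense when the sphere is empty (dimension \<open>0\<close>).
\<close>

lemma quadratic_family_bounds:
  fixes g :: "'x::topological_space \<Rightarrow> 'e::real_inner \<Rightarrow> 'e \<Rightarrow> real"
  assumes fd: "\<exists>B::'e set. finite B \<and> span B = UNIV"
    and S: "compact S"
    and bil: "\<And>x. x \<in> S \<Longrightarrow> bilinear (g x)"
    and pos: "\<And>x v. x \<in> S \<Longrightarrow> v \<noteq> 0 \<Longrightarrow> g x v v > 0"
    and cont: "\<And>v w. continuous_on S (\<lambda>x. g x v w)"
  obtains M where "M > 0"
    "\<And>x v. x \<in> S \<Longrightarrow> norm v \<le> M * sqrt (g x v v)"
    "\<And>x v. x \<in> S \<Longrightarrow> sqrt (g x v v) \<le> M * norm v"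
proof -
  let ?U = "S \<times> sphere (0::'e) 1" and ?F = "\<lambda>(x, v). sqrt (g x v v)"
  have "closed (sphere (0::'e) 1)"
    unfolding sphere_def by (rule closed_Collect_eq) (intro continuous_intros)+
  with compact_cball_finite_span[OF fd, of 0 1] have "compact (cball (0::'e) 1 \<inter> sphere 0 1)"
    by (rule compact_Int_closed)
  moreover have "cball (0::'e) 1 \<inter> sphere 0 1 = sphere 0 1"
    by auto
  ultimately have "compact (sphere (0::'e) 1)"
    by simp
  with S have U: "compact ?U"
    by (rule compact_Times)
  have "continuous_on (S \<times> UNIV) (\<lambda>(x, v). g x v v)"
    using fd bil cont by (rule continuous_on_quadratic_family)
  then have "continuous_on ?U (\<lambda>(x, v). g x v v)"
    by (rule continuous_on_subset) auto
  then have F: "continuous_on ?U ?F"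
    using continuous_on_real_sqrt by (fastforce simp: case_prod_beta)
  have Fpos: "?F z > 0" if "z \<in> ?U" for z
    using that by (cases z) (auto intro!: pos)
  then have G: "continuous_on ?U (\<lambda>z. inverse (?F z))"
    using F by (intro continuous_on_inverse) force+
  obtain M1 where M1: "M1 > 0" "\<And>z. z \<in> ?U \<Longrightarrow> norm (?F z) \<le> M1"
    using compact_imp_bounded[OF compact_continuous_image[OF F U]] unfolding bounded_pos by blast
  obtain M2 where M2: "M2 > 0" "\<And>z. z \<in> ?U \<Longrightarrow> norm (inverse (?F z)) \<le> M2"
    using compact_imp_bounded[OF compact_continuous_image[OF G U]] unfolding bounded_pos by blast
  have key: "norm v \<le> max M1 M2 * sqrt (g x v v) \<and> sqrt (g x v v) \<le> max M1 M2 * norm v"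
    if x: "x \<in> S" for x v
  proof (cases "v = 0")
    case True
    then show ?thesis using bil[OF x] by (simp add: bilinear_lzero)
  next
    case False
    define w where "w = v /\<^sub>R norm v"
    have v: "v = norm v *\<^sub>R w" and w: "(x, w) \<in> ?U"
      using False x by (auto simp: w_def)
    have "g x v v = (norm v)\<^sup>2 * g x w w"
    proof -
      have "g x v v = g x (norm v *\<^sub>R w) (norm v *\<^sub>R w)"
        by (simp flip: v)
      then show ?thesis
        using bil[OF x] by (simp add: bilinear_lmul bilinear_rmul power2_eq_square)
    qed
    then have s: "sqrt (g x v v) = norm v * ?F (x, w)"
      by (simp add: real_sqrt_mult)
    have p: "?F (x, w) > 0"
      using Fpos[OF w] .
    have a: "?F (x, w) \<le> max M1 M2"
      using M1(2)[OF w] by auto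
    have "inverse (?F (x, w)) \<le> max M1 M2"
      using M2(2)[OF w] p by (auto simp del: real_sqrt_gt_0_iff)
    then have b: "1 \<le> max M1 M2 * ?F (x, w)"
      using p by (simp add: inverse_eq_divide pos_divide_le_eq del: max_def)
    show ?thesis
      unfolding s using mult_left_mono[OF a norm_ge_zero[of v]] mult_left_mono[OF b norm_ge_zero[of v]]
      by (simp add: mult_ac)
  qed
  show ?thesis
    using key M1(1) by (intro that[of "max M1 M2"]) auto
qed


section \<open>Charts, velocities and the speed of curves\<close>

lemma smooth_manifoldD:
  assumes "smooth_manifold A"
  shows "c \<in> A \<Longrightarrow> topological_chart c" and "\<Union>(fst ` A) = UNIV"
    and "c \<in> A \<Longrightarrow> d \<in> A \<Longrightarrow> compatible c d"
proof -
  have "\<forall>c\<in>A. topological_chart c" "\<Union>(fst ` A) = UNIV" "\<forall>c\<in>A. \<forall>d\<in>A. compatible c d"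
    using assms unfolding smooth_manifold_def by - (elim conjE, assumption)+
  then show "c \<in> A \<Longrightarrow> topological_chart c" "\<Union>(fst ` A) = UNIV"
    "c \<in> A \<Longrightarrow> d \<in> A \<Longrightarrow> compatible c d"
    by simp_all
qed

lemma chart_props:
  assumes "smooth_manifold A" "(V, \<phi>) \<in> A"
  shows "open V" "open (\<phi> ` V)" "continuous_on V \<phi>" "continuous_on (\<phi> ` V) (inv_into V \<phi>)"
    and "\<And>p. p \<in> V \<Longrightarrow> inv_into V \<phi> (\<phi> p) = p"
    and "\<And>x. x \<in> \<phi> ` V \<Longrightarrow> \<phi> (inv_into V \<phi> x) = x"
    and "\<And>x. x \<in> \<phi> ` V \<Longrightarrow> inv_into V \<phi> x \<in> V"
proof -
  have "topological_chart (V, \<phi>)"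
    using assms by (rule smooth_manifoldD)
  then have *: "open V" "open (\<phi> ` V)" "homeomorphism V (\<phi> ` V) \<phi> (inv_into V \<phi>)"
    by (auto simp: topological_chart_def)
  show "open V" "open (\<phi> ` V)" "continuous_on V \<phi>" "continuous_on (\<phi> ` V) (inv_into V \<phi>)"
    using * by (auto simp: homeomorphism_def)
  show "\<And>p. p \<in> V \<Longrightarrow> inv_into V \<phi> (\<phi> p) = p"
    using * by (auto simp: homeomorphism_def)
  show "\<And>x. x \<in> \<phi> ` V \<Longrightarrow> \<phi> (inv_into V \<phi> x) = x" "\<And>x. x \<in> \<phi> ` V \<Longrightarrow> inv_into V \<phi> x \<in> V"
    by (auto simp: f_inv_into_f inv_into_into)
qed

lemma chart_around:
  assumes "smooth_manifold A"
  obtains V \<phi> where "(V, \<phi>) \<in> A" "p \<in> V"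
proof -
  have "\<Union>(fst ` A) = UNIV"
    using assms by (rule smooth_manifoldD)
  then have "p \<in> \<Union>(fst ` A)"
    by simp
  then show ?thesis
    using that by force
qed

lemma open_chart_preimage:
  assumes "smooth_manifold A" "(V, \<phi>) \<in> A" "open S"
  shows "open (V \<inter> \<phi> -` S)"
  using continuous_open_preimage[OF chart_props(3)[OF assms(1,2)] chart_props(1)[OF assms(1,2)] assms(3)] .

lemma open_chart_image:
  assumes "smooth_manifold A" "(V, \<phi>) \<in> A" "open W"
  shows "open (\<phi> ` (V \<inter> W))"
proof -
  note c = chart_props[OF assms(1,2)]
  have "open (\<phi> ` V \<inter> inv_into V \<phi> -` W)"
    using continuous_open_preimage[OF c(4) c(2) assms(3)] .
  moreover have "\<phi> ` (V \<inter> W) = \<phi> ` V \<inter> inv_into V \<phi> -` W"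
    using c(5-7) by force
  ultimately show ?thesis by simp
qed

lemma smooth_on_differentiable: "smooth_on S f \<Longrightarrow> x \<in> S \<Longrightarrow> f differentiable (at x)"
  unfolding smooth_on_def by (metis total_deriv.simps(1))

lemma chart_transition_differentiable:
  assumes "smooth_manifold A" "(V, \<phi>) \<in> A" "(W, \<psi>) \<in> A" "p \<in> V" "p \<in> W"
  shows "(\<psi> \<circ> inv_into V \<phi>) differentiable (at (\<phi> p))"
proof -
  have "compatible (V, \<phi>) (W, \<psi>)"
    using assms(1-3) by (rule smooth_manifoldD)
  then have "smooth_on (\<phi> ` (V \<inter> W)) (\<psi> \<circ> inv_into V \<phi>)"
    by (simp add: compatible_def)
  then show ?thesis
    using assms by (auto intro: smooth_on_differentiable)
qed

text \<open>
  Continuity keeps the curve in the domain of a chart for a while, so that the arbitrary values of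
  the chart outside its domain do not affect derivatives at \<open>t\<close>.
\<close>

definition differentiable_in_charts_at ::
  "('a::t2_space, 'e::real_inner) atlas \<Rightarrow> (real \<Rightarrow> 'a) \<Rightarrow> real \<Rightarrow> bool" where
  "differentiable_in_charts_at A c t \<longleftrightarrow>
     isCont c t \<and> (\<forall>(V, \<phi>)\<in>A. c t \<in> V \<longrightarrow> (\<phi> \<circ> c) differentiable (at t))"

lemma differentiable_in_chartsD:
  assumes "differentiable_in_charts_at A c t"
  shows "isCont c t" and "(V, \<phi>) \<in> A \<Longrightarrow> c t \<in> V \<Longrightarrow> (\<phi> \<circ> c) differentiable (at t)"
  using assms unfolding differentiable_in_charts_at_def by fast+

text \<open>
  The chain rule for \<open>\<psi> \<circ> c = (\<psi> \<circ> \<phi>\<^sup>-\<^sup>1) \<circ> (\<phi> \<circ> c)\<close>, an equation that holds only while \<open>c\<close> stays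
  in \<open>V\<close>, hence near \<open>t\<close> by continuity.
\<close>

lemma velocity_chart_change:
  assumes A: "smooth_manifold A" "(V, \<phi>) \<in> A" "(W, \<psi>) \<in> A" "c t \<in> V" "c t \<in> W"
    and c: "differentiable_in_charts_at A c t"
  shows "vector_derivative (\<psi> \<circ> c) (at t) =
    frechet_derivative (\<psi> \<circ> inv_into V \<phi>) (at (\<phi> (c t))) (vector_derivative (\<phi> \<circ> c) (at t))"
proof -
  let ?D = "frechet_derivative (\<psi> \<circ> inv_into V \<phi>) (at (\<phi> (c t)))"
  let ?v = "vector_derivative (\<phi> \<circ> c) (at t)"
  note ch = chart_props[OF A(1,2)]
  have D: "((\<psi> \<circ> inv_into V \<phi>) has_derivative ?D) (at ((\<phi> \<circ> c) t))"
    using chart_transition_differentiable[OF A] by (simp add: frechet_derivative_works)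
  have "(\<phi> \<circ> c) differentiable (at t)"
    by (rule differentiable_in_chartsD(2)[OF c A(2,4)])
  then have v: "((\<phi> \<circ> c) has_derivative (\<lambda>s. s *\<^sub>R ?v)) (at t)"
    using vector_derivative_works has_vector_derivative_def by metis
  have "((\<psi> \<circ> inv_into V \<phi>) \<circ> (\<phi> \<circ> c) has_derivative ?D \<circ> (\<lambda>s. s *\<^sub>R ?v)) (at t)"
    using diff_chain_at[OF v D] .
  moreover have "\<forall>\<^sub>F s in nhds t. c s \<in> V"
    using differentiable_in_chartsD(1)[OF c] topological_tendstoD[OF _ ch(1) A(4), of c "nhds t"]
    by (simp add: isCont_def tendsto_at_iff_tendsto_nhds)
  then obtain U where "open U" "t \<in> U" "\<And>s. s \<in> U \<Longrightarrow> c s \<in> V"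
    unfolding eventually_nhds by blast
  ultimately have "(\<psi> \<circ> c has_derivative ?D \<circ> (\<lambda>s. s *\<^sub>R ?v)) (at t)"
    by (elim has_derivative_transform_within_open[of _ _ _ _ U]) (simp_all add: ch(5))
  moreover have "?D \<circ> (\<lambda>s. s *\<^sub>R ?v) = (\<lambda>s. s *\<^sub>R ?D ?v)"
    using D has_derivative_linear linear_scale by (fastforce simp: fun_eq_iff)
  ultimately show ?thesis
    by (intro vector_derivative_at) (simp add: has_vector_derivative_def)
qed

text \<open>
  The description of \<open>curve_speed\<close> determines a unique number: the velocities in two charts
  differ by the derivative of the transition map, and the transformation law of the metric absorbs
  this derivative.
\<close>

lemma curve_speed_in_chart:
  assumes A: "smooth_manifold A" "riemannian_metric A h" "(V, \<phi>) \<in> A" "c t \<in> V"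
    and c: "differentiable_in_charts_at A c t"
  shows "curve_speed A h c t =
    sqrt (h (V, \<phi>) (c t) (vector_derivative (\<phi> \<circ> c) (at t)) (vector_derivative (\<phi> \<circ> c) (at t)))"
    (is "_ = ?s")
  unfolding curve_speed_def
proof (rule the_equality)
  show "\<exists>(V, \<phi>)\<in>A. c t \<in> V \<and> (let v = vector_derivative (\<phi> \<circ> c) (at t) in ?s = sqrt (h (V, \<phi>) (c t) v v))"
    using A by (auto simp: Let_def)
next
  fix s assume "\<exists>(V, \<phi>)\<in>A. c t \<in> V \<and> (let v = vector_derivative (\<phi> \<circ> c) (at t) in s = sqrt (h (V, \<phi>) (c t) v v))"
  then obtain W \<psi> where W: "(W, \<psi>) \<in> A" "c t \<in> W"
    and s: "s = sqrt (h (W, \<psi>) (c t) (vector_derivative (\<psi> \<circ> c) (at t)) (vector_derivative (\<psi> \<circ> c) (at t)))"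
    by (auto simp: Let_def)
  let ?D = "frechet_derivative (\<psi> \<circ> inv_into V \<phi>) (at (\<phi> (c t)))"
  have "\<forall>(V, \<phi>)\<in>A. \<forall>(W, \<psi>)\<in>A. \<forall>p\<in>V \<inter> W. \<forall>v w.
        (let D = frechet_derivative (\<psi> \<circ> inv_into V \<phi>) (at (\<phi> p))
         in h (V, \<phi>) p v w = h (W, \<psi>) p (D v) (D w))"
    using A(2) unfolding riemannian_metric_def by blast
  from bspec[OF bspec[OF this A(3), unfolded prod.case] W(1), unfolded prod.case Let_def] A(4) W(2)
  have "h (V, \<phi>) (c t) v w = h (W, \<psi>) (c t) (?D v) (?D w)" for v w
    by blast
  then show "s = ?s"
    unfolding s velocity_chart_change[OF A(1,3) W(1) A(4) W(2) c] by simp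
qed

text \<open>
  A smooth piece of a curve is a restriction of a smooth curve \<open>\<gamma>\<close> on a larger open set.
  In the interior of the piece, differentiability and velocity are those of \<open>\<gamma>\<close>.
\<close>

lemma differentiable_in_charts_at_local:
  assumes "differentiable_in_charts_at A \<gamma> t" "open S" "t \<in> S" "\<And>s. s \<in> S \<Longrightarrow> c s = \<gamma> s"
  shows "differentiable_in_charts_at A c t"
    and "(V, \<phi>) \<in> A \<Longrightarrow> c t \<in> V \<Longrightarrow> vector_derivative (\<phi> \<circ> c) (at t) = vector_derivative (\<phi> \<circ> \<gamma>) (at t)"
proof -
  have v: "(\<phi> \<circ> c has_vector_derivative vector_derivative (\<phi> \<circ> \<gamma>) (at t)) (at t)"
    if "(V, \<phi>) \<in> A" "c t \<in> V" for V \<phi>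
  proof -
    have "(\<phi> \<circ> \<gamma>) differentiable (at t)"
      using differentiable_in_chartsD(2)[OF assms(1) that(1)] that(2) assms(3,4) by simp
    then have "(\<phi> \<circ> \<gamma> has_vector_derivative vector_derivative (\<phi> \<circ> \<gamma>) (at t)) (at t)"
      by (simp add: vector_derivative_works)
    then show ?thesis
      using assms(2,3) by (rule has_vector_derivative_transform_within_open) (simp add: assms(4))
  qed
  have "\<forall>\<^sub>F s in nhds t. c s = \<gamma> s"
    using assms(2-4) unfolding eventually_nhds by blast
  from isCont_cong[OF this] have "isCont c t"
    using differentiable_in_chartsD(1)[OF assms(1)] by simp
  moreover have "\<forall>(V, \<phi>)\<in>A. c t \<in> V \<longrightarrow> (\<phi> \<circ> c) differentiable (at t)"
    using differentiableI_vector[OF v] by blast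
  ultimately show "differentiable_in_charts_at A c t"
    by (simp add: differentiable_in_charts_at_def)
  show "(V, \<phi>) \<in> A \<Longrightarrow> c t \<in> V \<Longrightarrow> vector_derivative (\<phi> \<circ> c) (at t) = vector_derivative (\<phi> \<circ> \<gamma>) (at t)"
    using v vector_derivative_at by blast
qed

lemma metric_in_chart:
  assumes "riemannian_metric A h" "(V, \<phi>) \<in> A"
  shows "\<And>p. p \<in> V \<Longrightarrow> bilinear (h (V, \<phi>) p)"
    and "\<And>p v. p \<in> V \<Longrightarrow> v \<noteq> 0 \<Longrightarrow> h (V, \<phi>) p v v > 0"
    and "\<And>v w. continuous_on (\<phi> ` V) (\<lambda>x. h (V, \<phi>) (inv_into V \<phi> x) v w)"
proof -
  have 1: "\<forall>(V, \<phi>)\<in>A. \<forall>p\<in>V. bilinear (h (V, \<phi>) p) \<and>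
        (\<forall>v w. h (V, \<phi>) p v w = h (V, \<phi>) p w v) \<and> (\<forall>v. v \<noteq> 0 \<longrightarrow> h (V, \<phi>) p v v > 0)"
    and 2: "\<forall>(V, \<phi>)\<in>A. \<forall>v w. smooth_on (\<phi> ` V) (\<lambda>x. h (V, \<phi>) (inv_into V \<phi> x) v w)"
    using assms(1) unfolding riemannian_metric_def by blast+
  show "\<And>p. p \<in> V \<Longrightarrow> bilinear (h (V, \<phi>) p)" "\<And>p v. p \<in> V \<Longrightarrow> v \<noteq> 0 \<Longrightarrow> h (V, \<phi>) p v v > 0"
    using 1 assms(2) by fast+
  fix v w
  have "smooth_on (\<phi> ` V) (\<lambda>x. h (V, \<phi>) (inv_into V \<phi> x) v w)"
    using 2 assms(2) by fast
  then show "continuous_on (\<phi> ` V) (\<lambda>x. h (V, \<phi>) (inv_into V \<phi> x) v w)"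
    by (intro continuous_at_imp_continuous_on ballI differentiable_imp_continuous_within)
      (rule smooth_on_differentiable)
qed

lemma model_space_finite_dimensional:
  fixes A :: "('a::t2_space, 'e::real_inner) atlas"
  shows "smooth_manifold A \<Longrightarrow> \<exists>B::'e set. finite B \<and> span B = UNIV"
  by (simp add: smooth_manifold_def)

text \<open>
  Continuity of the speed is a local matter. In one chart the speed is obtained from the position and
  the velocity, both continuous in time, by the jointly continuous quadratic form of the metric.
\<close>

lemma smooth_curve_speed:
  assumes A: "smooth_manifold A" "riemannian_metric A h"
    and S: "open S" and \<gamma>: "continuous_on S \<gamma>"
    and sm: "\<forall>(V, \<phi>)\<in>A. smooth_on (S \<inter> \<gamma> -` V) (\<phi> \<circ> \<gamma>)"
  shows "\<And>t. t \<in> S \<Longrightarrow> differentiable_in_charts_at A \<gamma> t"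
    and "continuous_on S (curve_speed A h \<gamma>)"
proof -
  show d: "differentiable_in_charts_at A \<gamma> t" if "t \<in> S" for t
    using that S \<gamma> sm unfolding differentiable_in_charts_at_def
    by (auto simp: continuous_on_eq_continuous_at split: prod.splits intro!: smooth_on_differentiable)
  have "isCont (curve_speed A h \<gamma>) t" if t: "t \<in> S" for t
  proof -
    obtain V \<phi> where V: "(V, \<phi>) \<in> A" "\<gamma> t \<in> V"
      using chart_around[OF A(1)] .
    note ch = chart_props[OF A(1) V(1)]
    define T where "T = S \<inter> \<gamma> -` V"
    have T: "open T" "t \<in> T"
      using continuous_open_preimage[OF \<gamma> S ch(1)] t V by (auto simp: T_def)
    let ?v = "\<lambda>s. total_deriv (\<phi> \<circ> \<gamma>) [1] s"
    have smT: "smooth_on T (\<phi> \<circ> \<gamma>)"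
      using sm V by (auto simp: T_def)
    have "continuous_on T ?v"
      using smT unfolding smooth_on_def
      by (intro continuous_at_imp_continuous_on ballI differentiable_imp_continuous_within) blast
    moreover have "continuous_on T (\<phi> \<circ> \<gamma>)"
      by (intro continuous_at_imp_continuous_on ballI differentiable_imp_continuous_within
            smooth_on_differentiable[OF smT])
    ultimately have 1: "continuous_on T (\<lambda>s. ((\<phi> \<circ> \<gamma>) s, ?v s))"
      by (rule continuous_on_Pair[rotated])
    have 2: "continuous_on (\<phi> ` V \<times> UNIV) (\<lambda>(x, v). h (V, \<phi>) (inv_into V \<phi> x) v v)"
      using metric_in_chart[OF A(2) V(1)] ch(7)
      by (intro continuous_on_quadratic_family model_space_finite_dimensional[OF A(1)]) auto
    have "continuous_on T (\<lambda>s. (\<lambda>(x, v). h (V, \<phi>) (inv_into V \<phi> x) v v) ((\<phi> \<circ> \<gamma>) s, ?v s))"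
      by (rule continuous_on_compose2[OF 2 1]) (auto simp: T_def)
    then have "continuous_on T (\<lambda>s. sqrt (h (V, \<phi>) (inv_into V \<phi> (\<phi> (\<gamma> s))) (?v s) (?v s)))"
      by (intro continuous_on_real_sqrt) simp
    moreover have "sqrt (h (V, \<phi>) (inv_into V \<phi> (\<phi> (\<gamma> s))) (?v s) (?v s)) = curve_speed A h \<gamma> s"
      if "s \<in> T" for s
    proof -
      have s: "s \<in> S" "\<gamma> s \<in> V"
        using that by (auto simp: T_def)
      have "?v s = vector_derivative (\<phi> \<circ> \<gamma>) (at s)"
        using smooth_on_differentiable[OF smT that]
        by (simp add: frechet_derivative_eq_vector_derivative)
      then show ?thesis
        using curve_speed_in_chart[where c = \<gamma>, OF A V(1) s(2) d[OF s(1)]] ch(5)[OF s(2)] by simp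
    qed
    ultimately have "continuous_on T (curve_speed A h \<gamma>)"
      using continuous_on_eq by blast
    then show ?thesis
      using T by (simp add: continuous_on_eq_continuous_at)
  qed
  then show "continuous_on S (curve_speed A h \<gamma>)"
    by (intro continuous_at_imp_continuous_on) blast
qed

text \<open>
  This is all that is used of a piecewise smooth curve, in a form that is inherited by concatenations.
  Integrability of the speed is part of it because the integral of a non-integrable function is
  \<open>0\<close>, which would void any lower bound for the length.
\<close>

definition rectifiable_between ::
  "('a::t2_space, 'e::real_inner) atlas \<Rightarrow> ('a, 'e) metric_tensor \<Rightarrow> (real \<Rightarrow> 'a) \<Rightarrow> real \<Rightarrow> real \<Rightarrow> bool" where
  "rectifiable_between A h c a b \<longleftrightarrow>
     continuous_on {a..b} c \<and> curve_speed A h c integrable_on {a..b} \<and>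
     (\<exists>E. finite E \<and> (\<forall>t\<in>{a..b} - E. differentiable_in_charts_at A c t))"

text \<open>
  At the two end points the speed of \<open>c\<close> need not agree with that of its smooth extension, since
  \<open>c\<close> may continue differently beyond them. Two points do not affect integrability.
\<close>

lemma smooth_curve_rectifiable:
  assumes A: "smooth_manifold A" "riemannian_metric A h" and c: "smooth_curve_on A c a b"
  shows "rectifiable_between A h c a b"
proof -
  obtain \<gamma> S where S: "open S" "{a..b} \<subseteq> S" "continuous_on S \<gamma>"
      "\<forall>(V, \<phi>)\<in>A. smooth_on (S \<inter> \<gamma> -` V) (\<phi> \<circ> \<gamma>)"
    and eq: "\<forall>t\<in>{a..b}. \<gamma> t = c t"
    using c unfolding smooth_curve_on_def by blast
  note \<gamma> = smooth_curve_speed[OF A S(1,3,4)]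
  have inner: "differentiable_in_charts_at A c t \<and> curve_speed A h c t = curve_speed A h \<gamma> t"
    if t: "t \<in> {a..b} - {a, b}" for t
  proof -
    have d: "differentiable_in_charts_at A \<gamma> t"
      using \<gamma>(1) S(2) t by auto
    have ts: "open {a<..<b}" "t \<in> {a<..<b}" "\<And>s. s \<in> {a<..<b} \<Longrightarrow> c s = \<gamma> s"
      using t eq by auto
    have loc: "differentiable_in_charts_at A c t"
      by (rule differentiable_in_charts_at_local(1)[OF d ts(1,2)]) (rule ts(3))
    obtain V \<phi> where V: "(V, \<phi>) \<in> A" "c t \<in> V"
      using chart_around[OF A(1)] .
    then have V': "\<gamma> t \<in> V"
      using ts by auto
    have "vector_derivative (\<phi> \<circ> c) (at t) = vector_derivative (\<phi> \<circ> \<gamma>) (at t)"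
      by (rule differentiable_in_charts_at_local(2)[OF d ts(1,2)]) (use ts(3) V in auto)
    then show ?thesis
      using loc curve_speed_in_chart[where c = c, OF A V loc]
        curve_speed_in_chart[where c = \<gamma>, OF A V(1) V' d] ts by auto
  qed
  have "continuous_on {a..b} c"
    using continuous_on_subset[OF S(3,2)] eq by (auto intro: continuous_on_eq)
  moreover have int: "curve_speed A h \<gamma> integrable_on {a..b}"
    by (intro integrable_continuous_interval continuous_on_subset[OF \<gamma>(2) S(2)])
  moreover have "curve_speed A h c integrable_on {a..b}"
    by (rule integrable_spike_finite[OF _ _ int, of "{a, b}"]) (use inner in auto)
  moreover have "finite {a, b}" "\<forall>t\<in>{a..b} - {a, b}. differentiable_in_charts_at A c t"
    using inner by auto
  ultimately show ?thesis
    unfolding rectifiable_between_def by blast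
qed

lemma rectifiable_combine:
  assumes "a \<le> b" "b \<le> d" "rectifiable_between A h c a b" "rectifiable_between A h c b d"
  shows "rectifiable_between A h c a d"
proof -
  obtain E F where E: "finite E" "\<forall>t\<in>{a..b} - E. differentiable_in_charts_at A c t"
    and F: "finite F" "\<forall>t\<in>{b..d} - F. differentiable_in_charts_at A c t"
    using assms unfolding rectifiable_between_def by blast
  have "continuous_on ({a..b} \<union> {b..d}) c"
    using assms by (intro continuous_on_closed_Un) (auto simp: rectifiable_between_def)
  then have "continuous_on {a..d} c"
    using assms by (simp add: ivl_disj_un_two_touch)
  moreover have "curve_speed A h c integrable_on {a..d}"
    using assms Henstock_Kurzweil_Integration.integrable_combine
    unfolding rectifiable_between_def by blast
  moreover have "\<forall>t\<in>{a..d} - (E \<union> F). differentiable_in_charts_at A c t"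
    using E F by force
  ultimately show ?thesis
    using E F unfolding rectifiable_between_def by blast
qed

lemma piecewise_smooth_curve_rectifiable:
  assumes A: "smooth_manifold A" "riemannian_metric A h" and c: "piecewise_smooth_curve A c"
  shows "rectifiable_between A h c 0 1"
proof -
  obtain n and t :: "nat \<Rightarrow> real" where t: "t 0 = 0" "t n = 1"
    and p: "\<And>i. i < n \<Longrightarrow> t i < t (Suc i) \<and> smooth_curve_on A c (t i) (t (Suc i))"
    using c unfolding piecewise_smooth_curve_def by blast
  have "0 < n"
    using t by (cases n) auto
  have "i < n \<Longrightarrow> 0 < t (Suc i) \<and> rectifiable_between A h c 0 (t (Suc i))" for i
  proof (induction i)
    case 0
    then show ?case
      using p[of 0] t smooth_curve_rectifiable[OF A, of c "t 0" "t (Suc 0)"] by auto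
  next
    case (Suc i)
    then have "rectifiable_between A h c (t (Suc i)) (t (Suc (Suc i)))" "t (Suc i) < t (Suc (Suc i))"
      using p[of "Suc i"] smooth_curve_rectifiable[OF A] by auto
    then show ?case
      using Suc rectifiable_combine[of 0 "t (Suc i)" "t (Suc (Suc i))" A h c] by auto
  qed
  from this[of "n - 1"] show ?thesis
    using t \<open>0 < n\<close> by simp
qed


section \<open>Riemannian distance in a chart ball\<close>

text \<open>
  Restricting a smooth map to a line is the only composition whose higher derivatives are needed;
  there they have the closed form \<open>D\<^sup>(\<^sup>k\<^sup>)g(t)(s\<^sub>1, \<dots>, s\<^sub>k) = s\<^sub>1 \<cdots> s\<^sub>k D\<^sup>(\<^sup>k\<^sup>)f(x + t w)(w, \<dots>, w)\<close>, so the general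
  chain rule of order \<open>k\<close> can be avoided.
\<close>

lemma total_deriv_along_line:
  fixes f :: "'e::real_normed_vector \<Rightarrow> 'f::real_normed_vector" and x w :: 'e
  assumes S: "open S" and f: "smooth_on S f"
  defines "g \<equiv> \<lambda>t::real. f (x + t *\<^sub>R w)"
  shows "x + t *\<^sub>R w \<in> S \<Longrightarrow>
      total_deriv g vs t = prod_list vs *\<^sub>R total_deriv f (replicate (length vs) w) (x + t *\<^sub>R w)"
    and "x + t *\<^sub>R w \<in> S \<Longrightarrow> total_deriv g vs differentiable (at t)"
proof -
  let ?l = "\<lambda>t. x + t *\<^sub>R w" and ?r = "\<lambda>vs::real list. replicate (length vs) w"
  have opn: "open (?l -` S)"
    by (intro open_vimage S continuous_intros)
  have step: "(total_deriv g vs has_derivative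
      (\<lambda>s. prod_list vs *\<^sub>R frechet_derivative (total_deriv f (?r vs)) (at (?l t)) (s *\<^sub>R w))) (at t)"
    if t: "?l t \<in> S"
      and eq: "\<And>t. ?l t \<in> S \<Longrightarrow> total_deriv g vs t = prod_list vs *\<^sub>R total_deriv f (?r vs) (?l t)"
    for vs t
  proof -
    have "total_deriv f (?r vs) differentiable (at (?l t))"
      using f t by (auto simp: smooth_on_def)
    then have "(total_deriv f (?r vs) has_derivative
        frechet_derivative (total_deriv f (?r vs)) (at (?l t))) (at (?l t))"
      by (simp add: frechet_derivative_works)
    moreover have "(?l has_derivative (\<lambda>s. s *\<^sub>R w)) (at t)"
      by (auto intro!: derivative_eq_intros)
    ultimately have "((\<lambda>t. total_deriv f (?r vs) (?l t)) has_derivative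
        (\<lambda>s. frechet_derivative (total_deriv f (?r vs)) (at (?l t)) (s *\<^sub>R w))) (at t)"
      by (rule has_derivative_compose[rotated])
    then have "((\<lambda>t. prod_list vs *\<^sub>R total_deriv f (?r vs) (?l t)) has_derivative
        (\<lambda>s. prod_list vs *\<^sub>R frechet_derivative (total_deriv f (?r vs)) (at (?l t)) (s *\<^sub>R w))) (at t)"
      by (rule has_derivative_scaleR_right)
    then show ?thesis
      by (rule has_derivative_transform_within_open[OF _ opn]) (use t eq in auto)
  qed
  have eq: "total_deriv g vs t = prod_list vs *\<^sub>R total_deriv f (?r vs) (?l t)" if "?l t \<in> S" for vs t
    using that
  proof (induction vs arbitrary: t)
    case Nil
    then show ?case by (simp add: g_def)
  next
    case (Cons v vs)
    let ?D = "frechet_derivative (total_deriv f (?r vs)) (at (?l t))"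
    have "total_deriv f (?r vs) differentiable (at (?l t))"
      using f Cons.prems by (auto simp: smooth_on_def)
    then have "linear ?D"
      by (rule linear_frechet_derivative)
    then show ?case
      using frechet_derivative_at[OF step[OF Cons.prems Cons.IH], symmetric]
      by (simp add: linear_scale mult.commute)
  qed
  then show "x + t *\<^sub>R w \<in> S \<Longrightarrow>
      total_deriv g vs t = prod_list vs *\<^sub>R total_deriv f (?r vs) (x + t *\<^sub>R w)" .
  show "x + t *\<^sub>R w \<in> S \<Longrightarrow> total_deriv g vs differentiable (at t)"
    using step eq unfolding differentiable_def by blast
qed

text \<open>
  Straight segments in a chart are the competitors that bound the Riemannian distance from above.
  Such a curve must be smooth in every chart of the atlas, not only in the one in which it is straight.
\<close>

lemma chart_segment:
  fixes x w :: "'e::real_inner"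
  assumes A: "smooth_manifold A" "riemannian_metric A h" "(V, \<phi>) \<in> A"
    and seg: "\<And>t. t \<in> {0..1} \<Longrightarrow> x + t *\<^sub>R w \<in> \<phi> ` V"
  defines "c \<equiv> \<lambda>t. inv_into V \<phi> (x + t *\<^sub>R w)"
  shows "piecewise_smooth_curve A c"
    and "\<And>t. t \<in> {0..1} \<Longrightarrow> curve_speed A h c t = sqrt (h (V, \<phi>) (c t) w w)"
proof -
  note ch = chart_props[OF A(1,3)]
  let ?l = "\<lambda>t::real. x + t *\<^sub>R w"
  define S where "S = ?l -` (\<phi> ` V)"
  have S: "open S"
    unfolding S_def by (intro open_vimage ch(2) continuous_intros)
  have c: "continuous_on S c"
    unfolding c_def by (intro continuous_on_compose2[OF ch(4)] continuous_intros) (auto simp: S_def)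
  have sm: "\<forall>(W, \<psi>)\<in>A. smooth_on (S \<inter> c -` W) (\<psi> \<circ> c)"
  proof clarify
    fix W \<psi> assume W: "(W, \<psi>) \<in> A"
    have "compatible (V, \<phi>) (W, \<psi>)"
      using A(1,3) W by (rule smooth_manifoldD)
    then have 1: "smooth_on (\<phi> ` (V \<inter> W)) (\<psi> \<circ> inv_into V \<phi>)"
      by (simp add: compatible_def)
    have 2: "open (\<phi> ` (V \<inter> W))"
      using open_chart_image[OF A(1,3)] chart_props(1)[OF A(1) W] .
    have "?l t \<in> \<phi> ` (V \<inter> W)" if "t \<in> S \<inter> c -` W" for t
    proof -
      have "inv_into V \<phi> (?l t) \<in> V \<inter> W" "\<phi> (inv_into V \<phi> (?l t)) = ?l t"
        using that ch(6,7) by (auto simp: S_def c_def)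
      then show ?thesis by (metis imageI)
    qed
    moreover have "\<psi> \<circ> c = (\<lambda>t. (\<psi> \<circ> inv_into V \<phi>) (?l t))"
      by (auto simp: c_def)
    ultimately show "smooth_on (S \<inter> c -` W) (\<psi> \<circ> c)"
      using total_deriv_along_line(2)[OF 2 1] unfolding smooth_on_def by metis
  qed
  have sub: "{0..1} \<subseteq> S"
    using seg by (auto simp: S_def)
  have "smooth_curve_on A c 0 1"
    unfolding smooth_curve_on_def using S sub c sm by blast
  then show "piecewise_smooth_curve A c"
    unfolding piecewise_smooth_curve_def by (intro exI[of _ "1::nat"] exI[of _ real]) auto
  fix t :: real assume "t \<in> {0..1}"
  then have t: "t \<in> S" "c t \<in> V"
    using sub ch(7) by (auto simp: S_def c_def)
  have "(?l has_vector_derivative w) (at t)"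
    by (auto intro!: derivative_eq_intros)
  then have "(\<phi> \<circ> c has_vector_derivative w) (at t)"
    using S t(1) by (rule has_vector_derivative_transform_within_open)
      (use ch(6) in \<open>auto simp: c_def S_def\<close>)
  then have "vector_derivative (\<phi> \<circ> c) (at t) = w"
    by (rule vector_derivative_at)
  then show "curve_speed A h c t = sqrt (h (V, \<phi>) (c t) w w)"
    using curve_speed_in_chart[where c = c, OF A t(2) smooth_curve_speed(1)[OF A(1,2) S c sm t(1)]] by simp
qed

text \<open>
  A continuity argument, used for curves of small length and for images of segments under moderate
  maps. If a curve can move by at most \<open>r\<close> as long as it remains in the ball, and
  \<open>r\<close> is too small to reach the boundary, then it never leaves the ball: up to the first exit
  time it stays in a compact, hence closed, set inside the ball, and so it is still there at that time.
  Hausdorffness enters through the closedness of compact sets; without it the curve could leave the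
  chart domain without approaching the boundary of the ball.
\<close>

lemma curve_trapped_in_chart_ball:
  fixes c :: "real \<Rightarrow> 'b::t2_space" and \<psi> :: "'b \<Rightarrow> 'f::real_inner"
  assumes Y: "smooth_manifold A" "(W, \<psi>) \<in> A" and ball: "cball y R \<subseteq> \<psi> ` W"
    and c: "continuous_on {0..1} c" "c 0 \<in> W"
    and r: "0 \<le> r" and small: "dist y (\<psi> (c 0)) + r < R"
    and step: "\<And>s. s \<in> {0..1} \<Longrightarrow> (\<And>t. t \<in> {0..s} \<Longrightarrow> c t \<in> W \<and> \<psi> (c t) \<in> ball y R) \<Longrightarrow>
        dist (\<psi> (c 0)) (\<psi> (c s)) \<le> r"
  shows "c 1 \<in> W \<and> \<psi> (c 1) \<in> ball y R \<and> dist (\<psi> (c 0)) (\<psi> (c 1)) \<le> r"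
proof -
  note ch = chart_props[OF Y]
  define G where "G = W \<inter> \<psi> -` ball y R"
  have G: "open G"
    unfolding G_def by (rule open_chart_preimage[OF Y open_ball])
  \<comment> \<open>The compact set in which the curve remains strictly before a first exit time.\<close>
  define F where "F = inv_into W \<psi> ` cball (\<psi> (c 0)) r"
  have sub: "cball (\<psi> (c 0)) r \<subseteq> ball y R"
  proof
    fix z assume "z \<in> cball (\<psi> (c 0)) r"
    then show "z \<in> ball y R"
      using dist_triangle[of y z "\<psi> (c 0)"] small by simp
  qed
  also have "ball y R \<subseteq> \<psi> ` W"
    using ball ball_subset_cball by blast
  finally have sub': "cball (\<psi> (c 0)) r \<subseteq> \<psi> ` W" .
  have "compact F"
    unfolding F_def
    by (intro compact_continuous_image continuous_on_subset[OF ch(4) sub']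
        compact_cball_finite_span model_space_finite_dimensional[OF Y(1)])
  then have F: "closed F"
    by (rule compact_imp_closed)
  have FG: "F \<subseteq> G"
    using sub sub' ch(6,7) by (force simp: F_def G_def)
  \<comment> \<open>The times outside the ball; a first exit time would be their infimum.\<close>
  define B where "B = {0..1} \<inter> c -` (- G)"
  have all: "B = {}"
  proof (rule ccontr)
    assume ne: "B \<noteq> {}"
    have "closed B"
      unfolding B_def using c(1) G by (intro continuous_closed_preimage) auto
    have bdd: "bdd_below B"
      by (auto simp: B_def intro: bdd_belowI[of _ 0])
    define t where "t = Inf B"
    have t: "t \<in> B"
      unfolding t_def by (rule closed_contains_Inf[OF ne bdd \<open>closed B\<close>])
    have before: "c s \<in> G" if "0 \<le> s" "s < t" for s
      using that t cInf_lower[OF _ bdd, of s] by (force simp: B_def t_def)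
    have inF: "c s \<in> F" if "0 \<le> s" "s < t" for s
    proof -
      have "dist (\<psi> (c 0)) (\<psi> (c s)) \<le> r"
        by (rule step) (use before that t in \<open>auto simp: G_def B_def\<close>)
      moreover have "inv_into W \<psi> (\<psi> (c s)) = c s"
        using before[OF that] ch(5) by (auto simp: G_def)
      ultimately show ?thesis
        unfolding F_def by (metis imageI mem_cball)
    qed
    have "c 0 \<in> G"
      using c(2) small r by (simp add: G_def)
    then have "0 < t" "t \<le> 1"
      using t by (auto simp: B_def less_le)
    have "closed ({0..t} \<inter> c -` F)"
      using \<open>t \<le> 1\<close> by (intro continuous_closed_preimage F continuous_on_subset[OF c(1)]) auto
    moreover have "{0<..<t} \<subseteq> {0..t} \<inter> c -` F"
      using inF by auto
    ultimately have "closure {0<..<t} \<subseteq> {0..t} \<inter> c -` F"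
      by (rule closure_minimal[rotated])
    moreover have "t \<in> closure {0<..<t}"
      using \<open>0 < t\<close> by simp
    ultimately have "c t \<in> F"
      by blast
    then show False
      using FG t by (auto simp: B_def)
  qed
  have in_G: "c t \<in> W \<and> \<psi> (c t) \<in> ball y R" if "t \<in> {0..1}" for t
    using all that by (auto simp: B_def G_def)
  then show ?thesis
    using step[of 1] by simp
qed

text \<open>
  In a region where the Euclidean norm is at most \<open>M\<close> times the norm of the metric, the
  Euclidean displacement is at most \<open>M\<close> times the length. The model space need not be an
  instance of the class \<open>banach\<close>, which the fundamental theorem of calculus demands, so the
  theorem is applied to the component of the curve in the direction \<open>z\<close> of the displacement.
\<close>

lemma chart_displacement_le_length:
  assumes A: "smooth_manifold A" "riemannian_metric A h" "(V, \<phi>) \<in> A"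
    and c: "rectifiable_between A h c 0 1"
    and M: "M > 0" "\<And>x v. x \<in> K \<Longrightarrow> norm v \<le> M * sqrt (h (V, \<phi>) (inv_into V \<phi> x) v v)"
    and s: "s \<in> {0..1}" and inK: "\<And>t. t \<in> {0..s} \<Longrightarrow> c t \<in> V \<and> \<phi> (c t) \<in> K"
  shows "dist (\<phi> (c 0)) (\<phi> (c s)) \<le> M * curve_length A h c"
proof -
  note ch = chart_props[OF A(1,3)]
  obtain E where E: "finite E" "\<forall>t\<in>{0..1} - E. differentiable_in_charts_at A c t"
    and cont: "continuous_on {0..1} c" and int: "curve_speed A h c integrable_on {0..1}"
    using c unfolding rectifiable_between_def by blast
  \<comment> \<open>At the break points the speed carries no information; it is replaced by \<open>0\<close>.\<close>
  define sp where "sp t = (if t \<in> E then 0 else curve_speed A h c t)" for t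
  have spint: "sp integrable_on {0..1}"
    using int by (rule integrable_spike_finite[OF E(1), rotated]) (auto simp: sp_def)
  have len: "curve_length A h c = integral {0..1} sp"
    unfolding curve_length_def
    by (rule integral_spike[of E]) (auto simp: sp_def E(1) negligible_finite)
  have sp0: "0 \<le> sp t" if t: "t \<in> {0..1}" for t
  proof (cases "t \<in> E")
    case False
    obtain W \<psi> where W: "(W, \<psi>) \<in> A" "c t \<in> W"
      using chart_around[OF A(1)] .
    have "h (W, \<psi>) (c t) v v \<ge> 0" for v
      using metric_in_chart(1)[OF A(2) W] metric_in_chart(2)[OF A(2) W, of v]
      by (cases "v = 0") (auto simp: bilinear_lzero)
    moreover have "differentiable_in_charts_at A c t"
      using E(2) t False by blast
    ultimately show ?thesis
      using curve_speed_in_chart[where c = c, OF A(1,2) W] False by (simp add: sp_def)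
  qed (simp add: sp_def)
  have L0: "0 \<le> curve_length A h c"
    unfolding len by (rule integral_nonneg[OF spint sp0])
  have sub: "{0..s} \<subseteq> {0..1}"
    using s by auto
  have spints: "sp integrable_on {0..s}"
    using integrable_on_subinterval[OF spint sub] .
  define z where "z = \<phi> (c s) - \<phi> (c 0)"
  define f' where "f' t = (if t \<in> E then 0 else vector_derivative (\<phi> \<circ> c) (at t) \<bullet> z)" for t
  have "continuous_on {0..s} (\<phi> \<circ> c)"
    using inK by (intro continuous_on_compose continuous_on_subset[OF cont sub]
        continuous_on_subset[OF ch(3)]) auto
  then have fc: "continuous_on {0..s} (\<lambda>t. (\<phi> \<circ> c) t \<bullet> z)"
    by (intro continuous_on_inner continuous_on_const)
  have d: "((\<lambda>t. (\<phi> \<circ> c) t \<bullet> z) has_vector_derivative f' t) (at t)" if t: "t \<in> {0<..<s} - E" for t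
  proof -
    have "differentiable_in_charts_at A c t"
      using E(2) t s by auto
    then have "(\<phi> \<circ> c) differentiable (at t)"
      by (rule differentiable_in_chartsD(2)) (use A(3) inK[of t] t in auto)
    then have "(\<phi> \<circ> c has_vector_derivative vector_derivative (\<phi> \<circ> c) (at t)) (at t)"
      by (simp add: vector_derivative_works)
    then have "((\<lambda>t. (\<phi> \<circ> c) t \<bullet> z) has_vector_derivative vector_derivative (\<phi> \<circ> c) (at t) \<bullet> z) (at t)"
      by (rule bounded_linear.has_vector_derivative[OF bounded_linear_inner_left])
    then show ?thesis
      using t by (simp add: f'_def)
  qed
  have "(f' has_integral (\<phi> \<circ> c) s \<bullet> z - (\<phi> \<circ> c) 0 \<bullet> z) {0..s}"
    using s d fc by (intro fundamental_theorem_of_calculus_interior_strong[OF E(1)]) auto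
  then have fint: "(f' has_integral (norm z)\<^sup>2) {0..s}"
    by (simp add: z_def flip: inner_diff_left power2_norm_eq_inner)
  have le: "f' t \<le> (M * norm z) * sp t" if t: "t \<in> {0..s}" for t
  proof (cases "t \<in> E")
    case False
    let ?v = "vector_derivative (\<phi> \<circ> c) (at t)"
    have V: "c t \<in> V" "\<phi> (c t) \<in> K"
      using inK[OF t] by auto
    have "differentiable_in_charts_at A c t"
      using E(2) t s False by auto
    then have "norm ?v \<le> M * curve_speed A h c t"
      using curve_speed_in_chart[where c = c, OF A V(1)] M(2)[OF V(2), of ?v] ch(5)[OF V(1)] by simp
    then have "norm ?v * norm z \<le> (M * curve_speed A h c t) * norm z"
      by (rule mult_right_mono) simp
    moreover have "?v \<bullet> z \<le> norm ?v * norm z"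
      by (rule norm_cauchy_schwarz)
    ultimately show ?thesis
      using False by (simp add: f'_def sp_def mult_ac)
  qed (simp add: f'_def sp_def)
  have "(norm z)\<^sup>2 \<le> (M * norm z) * integral {0..s} sp"
    using le has_integral_mult_right[OF integrable_integral[OF spints], of "M * norm z"]
    by (intro has_integral_le[OF fint]) auto
  also have "\<dots> \<le> (M * norm z) * curve_length A h c"
    unfolding len using M(1) sp0
    by (intro mult_left_mono integral_subset_le sub spints spint) auto
  finally have "norm z * norm z \<le> norm z * (M * curve_length A h c)"
    by (simp add: power2_eq_square mult_ac)
  then have "norm z \<le> M * curve_length A h c"
    using L0 M(1) by (cases "z = 0") auto
  then show ?thesis
    by (simp add: z_def dist_norm norm_minus_commute)
qed

text \<open>
  The geometric core. Inside a compact chart ball, \<open>d\<^sub>h\<close> is at most a constant times the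
  Euclidean distance, as segments show. Conversely, every curve that starts in the ball and is too
  short to reach its boundary is trapped in it, and its length bounds the Euclidean displacement; in
  particular its end point lies in the chart. The second bound is stated for a number \<open>r\<close>
  strictly above the distance, so that a curve of length at most \<open>r\<close> exists although the
  infimum need not be attained.
\<close>

lemma chart_distance_comparison:
  assumes A: "smooth_manifold A" "riemannian_metric A h" "(V, \<phi>) \<in> A"
    and K: "cball y R \<subseteq> \<phi> ` V"
  obtains C where "C > 0"
    and "\<And>p q. p \<in> V \<Longrightarrow> q \<in> V \<Longrightarrow> \<phi> p \<in> cball y R \<Longrightarrow> \<phi> q \<in> cball y R \<Longrightarrow>
      riemannian_dist A h p q \<le> ennreal (C * dist (\<phi> p) (\<phi> q))"
    and "\<And>p q r. p \<in> V \<Longrightarrow> riemannian_dist A h p q < ennreal r \<Longrightarrow> dist y (\<phi> p) + C * r < R \<Longrightarrow>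
      q \<in> V \<and> \<phi> q \<in> ball y R \<and> dist (\<phi> p) (\<phi> q) \<le> C * r"
proof -
  note ch = chart_props[OF A(1,3)]
  note fd = model_space_finite_dimensional[OF A(1)]
  let ?g = "\<lambda>x. h (V, \<phi>) (inv_into V \<phi> x)"
  have KV: "inv_into V \<phi> x \<in> V" if "x \<in> cball y R" for x
    using ch(7) K that by blast
  obtain M where M: "M > 0" "\<And>x v. x \<in> cball y R \<Longrightarrow> norm v \<le> M * sqrt (?g x v v)"
    "\<And>x v. x \<in> cball y R \<Longrightarrow> sqrt (?g x v v) \<le> M * norm v"
  proof (rule quadratic_family_bounds[OF fd compact_cball_finite_span[OF fd, of y R], of ?g])
    show "\<And>x. x \<in> cball y R \<Longrightarrow> bilinear (?g x)"
      "\<And>x v. x \<in> cball y R \<Longrightarrow> v \<noteq> 0 \<Longrightarrow> 0 < ?g x v v"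
      using metric_in_chart(1,2)[OF A(2,3)] KV by blast+
    show "\<And>v w. continuous_on (cball y R) (\<lambda>x. ?g x v w)"
      by (rule continuous_on_subset[OF metric_in_chart(3)[OF A(2,3)] K])
  qed (rule that)
  show ?thesis
  proof (rule that[OF M(1)])
    fix p q assume p: "p \<in> V" "\<phi> p \<in> cball y R" and q: "q \<in> V" "\<phi> q \<in> cball y R"
    let ?w = "\<phi> q - \<phi> p"
    let ?c = "\<lambda>t::real. inv_into V \<phi> (\<phi> p + t *\<^sub>R ?w)"
    have seg: "\<phi> p + t *\<^sub>R ?w \<in> cball y R" if "t \<in> {0..1}" for t
      using convexD_alt[OF convex_cball p(2) q(2), of t] that by (simp add: algebra_simps)
    then have seg': "\<And>t. t \<in> {0..1} \<Longrightarrow> \<phi> p + t *\<^sub>R ?w \<in> \<phi> ` V"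
      using K by blast
    have cs: "piecewise_smooth_curve A ?c"
      by (rule chart_segment(1)[OF A seg'])
    have "curve_speed A h ?c t \<le> M * norm ?w" if "t \<in> {0..1}" for t
      using M(3)[OF seg[OF that], of ?w] chart_segment(2)[OF A seg' that] by simp
    then have "curve_length A h ?c \<le> integral {0..1} (\<lambda>t::real. M * norm ?w)"
      unfolding curve_length_def
      using piecewise_smooth_curve_rectifiable[OF A(1,2) cs]
      by (intro integral_le) (auto simp: rectifiable_between_def)
    then have "curve_length A h ?c \<le> M * dist (\<phi> p) (\<phi> q)"
      by (simp add: dist_norm norm_minus_commute)
    moreover have "riemannian_dist A h p q \<le> ennreal (curve_length A h ?c)"
      unfolding riemannian_dist_def using cs ch(5) p q by (intro INF_lower) auto
    ultimately show "riemannian_dist A h p q \<le> ennreal (M * dist (\<phi> p) (\<phi> q))"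
      by (meson ennreal_leI order_trans)
  next
    fix p q r assume p: "p \<in> V" and lt: "riemannian_dist A h p q < ennreal r"
      and small: "dist y (\<phi> p) + M * r < R"
    obtain c where c: "piecewise_smooth_curve A c" "c 0 = p" "c 1 = q"
      and less: "ennreal (curve_length A h c) < ennreal r"
      using lt unfolding riemannian_dist_def INF_less_iff by blast
    have len: "curve_length A h c \<le> r"
    proof (rule ccontr)
      assume "\<not> curve_length A h c \<le> r"
      then have "ennreal r \<le> ennreal (curve_length A h c)"
        by (intro ennreal_leI) simp
      with less show False
        by simp
    qed
    have r: "0 \<le> r"
      using less by (cases "0 \<le> r") (auto simp: ennreal_neg)
    note rect = piecewise_smooth_curve_rectifiable[OF A(1,2) c(1)]
    have "c 1 \<in> V \<and> \<phi> (c 1) \<in> ball y R \<and> dist (\<phi> (c 0)) (\<phi> (c 1)) \<le> M * r"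
    proof (rule curve_trapped_in_chart_ball[OF A(1,3) K])
      show "continuous_on {0..1} c"
        using rect by (simp add: rectifiable_between_def)
      show "c 0 \<in> V" "0 \<le> M * r" "dist y (\<phi> (c 0)) + M * r < R"
        using p c r M(1) small by auto
      fix s :: real assume s: "s \<in> {0..1}"
        and inball: "\<And>t. t \<in> {0..s} \<Longrightarrow> c t \<in> V \<and> \<phi> (c t) \<in> ball y R"
      have "c t \<in> V \<and> \<phi> (c t) \<in> cball y R" if "t \<in> {0..s}" for t
        using inball[OF that] by simp
      then have "dist (\<phi> (c 0)) (\<phi> (c s)) \<le> M * curve_length A h c"
        by (intro chart_displacement_le_length[where K = "cball y R", OF A rect M(1) _ s])
          (use M(2) in blast)+
      also have "\<dots> \<le> M * r"
        using len M(1) by simp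
      finally show "dist (\<phi> (c 0)) (\<phi> (c s)) \<le> M * r" .
    qed
    then show "q \<in> V \<and> \<phi> q \<in> ball y R \<and> dist (\<phi> p) (\<phi> q) \<le> M * r"
      using c by simp
  qed
qed


section \<open>Infinitely close nets\<close>

text \<open>
  Asymptotic estimates along a net in a compact set can be proved locally: finitely many of the
  neighbourhoods cover the compact set, and the largest of their constants serves everywhere.
\<close>

lemma eventually_compact_localization:
  fixes a :: "'i \<Rightarrow> 'a::topological_space" and Pr :: "real \<Rightarrow> 'i \<Rightarrow> bool"
  assumes K: "compact K" "\<forall>\<^sub>F i in F. a i \<in> K"
    and mono: "\<And>C C' i. C \<le> C' \<Longrightarrow> Pr C i \<Longrightarrow> Pr C' i"
    and loc: "\<And>x. x \<in> K \<Longrightarrow> \<exists>W C. open W \<and> x \<in> W \<and> (\<forall>\<^sub>F i in F. a i \<in> W \<longrightarrow> Pr C i)"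
  shows "\<exists>C. \<forall>\<^sub>F i in F. Pr C i"
proof -
  obtain W C where WC: "\<And>x. x \<in> K \<Longrightarrow> open (W x) \<and> x \<in> W x \<and> (\<forall>\<^sub>F i in F. a i \<in> W x \<longrightarrow> Pr (C x) i)"
    using loc by metis
  have "K \<subseteq> (\<Union>x\<in>K. W x)"
    using WC by blast
  then obtain D where D: "D \<subseteq> K" "finite D" "K \<subseteq> (\<Union>x\<in>D. W x)"
    using compactE_image[OF K(1), of K W] WC by metis
  have "\<forall>\<^sub>F i in F. \<forall>x\<in>D. a i \<in> W x \<longrightarrow> Pr (C x) i"
    using D WC by (intro eventually_ball_finite) auto
  then have "\<forall>\<^sub>F i in F. Pr (Max (C ` D)) i"
    using K(2)
  proof eventually_elim
    case (elim i)
    then obtain x where x: "x \<in> D" "a i \<in> W x"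
      using D by blast
    show ?case
      by (rule mono[of "C x"]) (use elim x D in auto)
  qed
  then show ?thesis by blast
qed

lemma powr_tendsto_0_at_right:
  fixes C m :: real
  assumes "m > 0"
  shows "((\<lambda>\<epsilon>. C * \<epsilon> powr m) \<longlongrightarrow> 0) (at_right 0)"
proof -
  have "((\<lambda>\<epsilon>. \<epsilon> powr m) \<longlongrightarrow> 0) (at_right (0::real))"
    by (rule tendsto_zero_powrI[OF _ tendsto_const])
      (use assms in \<open>auto simp: tendsto_ident_at eventually_at_filter\<close>)
  then show ?thesis
    by (rule tendsto_mult_right_zero)
qed

lemma eventually_powr_less:
  fixes C m \<delta> :: real
  assumes "m > 0" "\<delta> > 0"
  shows "\<forall>\<^sub>F \<epsilon> in at_right 0. C * \<epsilon> powr m < \<delta>"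
  using order_tendstoD(2)[OF powr_tendsto_0_at_right[OF assms(1)] assms(2)] .

lemma eventually_at_right_positive: "\<forall>\<^sub>F \<epsilon> in at_right (0::real). 0 < \<epsilon>"
  by (simp add: eventually_at_filter)

lemma chart_cball:
  assumes "smooth_manifold A" "(V, \<phi>) \<in> A" "x \<in> V"
  obtains R where "R > 0" "cball (\<phi> x) R \<subseteq> \<phi> ` V"
proof -
  have "\<exists>R>0. cball (\<phi> x) R \<subseteq> \<phi> ` V"
    using bspec[OF iffD1[OF open_contains_cball chart_props(2)[OF assms(1,2)]] imageI[OF assms(3)]] .
  then obtain R where "R > 0" "cball (\<phi> x) R \<subseteq> \<phi> ` V"
    by (elim exE conjE)
  then show ?thesis
    by (rule that)
qed

text \<open>
  The equivalence of compactly supported nets, expressed in charts. Unlike the relation defined by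
  the distance, it does not mention a metric, so it shows at once that the choice of the metric is
  immaterial; and the neighbourhood \<open>W\<close> does not depend on the exponent \<open>m\<close>.
\<close>

definition infinitely_close ::
  "('a::t2_space, 'e::real_inner) atlas \<Rightarrow> (real \<Rightarrow> 'a) \<Rightarrow> (real \<Rightarrow> 'a) \<Rightarrow> bool" where
  "infinitely_close A a b \<longleftrightarrow> (\<forall>V \<phi>. (V, \<phi>) \<in> A \<longrightarrow> (\<forall>x\<in>V. \<exists>W. open W \<and> x \<in> W \<and> W \<subseteq> V \<and>
     (\<forall>m>0. \<exists>C. \<forall>\<^sub>F \<epsilon> in at_right 0.
        a \<epsilon> \<in> W \<longrightarrow> b \<epsilon> \<in> V \<and> dist (\<phi> (a \<epsilon>)) (\<phi> (b \<epsilon>)) \<le> C * \<epsilon> powr m)))"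

lemma infinitely_closeE:
  assumes "infinitely_close A a b" "(V, \<phi>) \<in> A" "x \<in> V"
  obtains W where "open W" "x \<in> W" "W \<subseteq> V"
    "\<forall>m>0. \<exists>C. \<forall>\<^sub>F \<epsilon> in at_right 0.
        a \<epsilon> \<in> W \<longrightarrow> b \<epsilon> \<in> V \<and> dist (\<phi> (a \<epsilon>)) (\<phi> (b \<epsilon>)) \<le> C * \<epsilon> powr m"
proof -
  obtain W where "open W \<and> x \<in> W \<and> W \<subseteq> V \<and> (\<forall>m>0. \<exists>C. \<forall>\<^sub>F \<epsilon> in at_right 0.
        a \<epsilon> \<in> W \<longrightarrow> b \<epsilon> \<in> V \<and> dist (\<phi> (a \<epsilon>)) (\<phi> (b \<epsilon>)) \<le> C * \<epsilon> powr m)"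
    using bspec[OF mp[OF spec[OF spec[OF assms(1)[unfolded infinitely_close_def]]] assms(2)] assms(3)]
    by (rule exE)
  then show ?thesis
    by (intro that[of W]) simp_all
qed

lemma infinitely_close_if_distance_negligible:
  assumes A: "smooth_manifold A" "riemannian_metric A h"
    and d: "\<And>m. m > 0 \<Longrightarrow> bigO_eps (\<lambda>\<epsilon>. riemannian_dist A h (a \<epsilon>) (b \<epsilon>)) m"
  shows "infinitely_close A a b"
  unfolding infinitely_close_def
proof (intro allI impI ballI)
  fix V \<phi> x assume V: "(V, \<phi>) \<in> A" "x \<in> V"
  obtain R where R: "R > 0" "cball (\<phi> x) R \<subseteq> \<phi> ` V"
    using chart_cball[OF A(1) V] .
  obtain C where C: "C > 0"
    and up: "\<And>p q. p \<in> V \<Longrightarrow> q \<in> V \<Longrightarrow> \<phi> p \<in> cball (\<phi> x) R \<Longrightarrow> \<phi> q \<in> cball (\<phi> x) R \<Longrightarrow>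
        riemannian_dist A h p q \<le> ennreal (C * dist (\<phi> p) (\<phi> q))"
    and low: "\<And>p q r. p \<in> V \<Longrightarrow> riemannian_dist A h p q < ennreal r \<Longrightarrow> dist (\<phi> x) (\<phi> p) + C * r < R \<Longrightarrow>
      q \<in> V \<and> \<phi> q \<in> ball (\<phi> x) R \<and> dist (\<phi> p) (\<phi> q) \<le> C * r"
    using chart_distance_comparison[OF A V(1) R(2)] by metis
  define W where "W = V \<inter> \<phi> -` ball (\<phi> x) (R / 2)"
  have "open W"
    unfolding W_def by (rule open_chart_preimage[OF A(1) V(1) open_ball])
  moreover have "x \<in> W"
    using V R by (simp add: W_def)
  moreover have "\<exists>C. \<forall>\<^sub>F \<epsilon> in at_right 0.
      a \<epsilon> \<in> W \<longrightarrow> b \<epsilon> \<in> V \<and> dist (\<phi> (a \<epsilon>)) (\<phi> (b \<epsilon>)) \<le> C * \<epsilon> powr m" if m: "m > 0" for m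
  proof -
    obtain D where D: "\<forall>\<^sub>F \<epsilon> in at_right 0. riemannian_dist A h (a \<epsilon>) (b \<epsilon>) \<le> ennreal (D * \<epsilon> powr m)"
      using d[OF m] unfolding bigO_eps_def by blast
    \<comment> \<open>Adding \<open>1\<close> makes \<open>r \<epsilon>\<close> positive and strictly larger than the distance.\<close>
    define r where "r \<epsilon> = (\<bar>D\<bar> + 1) * \<epsilon> powr m" for \<epsilon>
    have "\<forall>\<^sub>F \<epsilon> in at_right 0. (C * (\<bar>D\<bar> + 1)) * \<epsilon> powr m < R / 2"
      using R(1) by (intro eventually_powr_less m) auto
    then have "\<forall>\<^sub>F \<epsilon> in at_right 0. a \<epsilon> \<in> W \<longrightarrow>
        b \<epsilon> \<in> V \<and> dist (\<phi> (a \<epsilon>)) (\<phi> (b \<epsilon>)) \<le> (C * (\<bar>D\<bar> + 1)) * \<epsilon> powr m"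
      using D eventually_at_right_positive
    proof eventually_elim
      case (elim \<epsilon>)
      have "D * \<epsilon> powr m < r \<epsilon>"
        using elim(3) by (simp add: r_def)
      moreover have "0 < r \<epsilon>"
        using elim(3) by (simp add: r_def)
      ultimately have "riemannian_dist A h (a \<epsilon>) (b \<epsilon>) < ennreal (r \<epsilon>)"
        using elim(2) ennreal_lessI le_less_trans by blast
      then show ?case
        using low[of "a \<epsilon>" "b \<epsilon>" "r \<epsilon>"] elim(1) by (auto simp: W_def r_def mult_ac)
    qed
    then show ?thesis by blast
  qed
  ultimately show "\<exists>W. open W \<and> x \<in> W \<and> W \<subseteq> V \<and> (\<forall>m>0. \<exists>C. \<forall>\<^sub>F \<epsilon> in at_right 0.
      a \<epsilon> \<in> W \<longrightarrow> b \<epsilon> \<in> V \<and> dist (\<phi> (a \<epsilon>)) (\<phi> (b \<epsilon>)) \<le> C * \<epsilon> powr m)"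
    by (intro exI[of _ W]) (auto simp: W_def)
qed

text \<open>
  Both orders of the arguments are bounded, because the Euclidean distance is symmetric. This yields
  the symmetry of the equivalence of generalized points without reversing curves.
\<close>

lemma distance_negligible_if_infinitely_close:
  assumes A: "smooth_manifold A" "riemannian_metric A h"
    and close: "infinitely_close A a b" and a: "a \<in> compactly_supported_nets" and m: "m > 0"
  shows "bigO_eps (\<lambda>\<epsilon>. riemannian_dist A h (a \<epsilon>) (b \<epsilon>)) m"
    and "bigO_eps (\<lambda>\<epsilon>. riemannian_dist A h (b \<epsilon>) (a \<epsilon>)) m"
proof -
  let ?Pr = "\<lambda>C \<epsilon>. riemannian_dist A h (a \<epsilon>) (b \<epsilon>) \<le> ennreal (C * \<epsilon> powr m) \<and>
    riemannian_dist A h (b \<epsilon>) (a \<epsilon>) \<le> ennreal (C * \<epsilon> powr m)"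
  obtain K where K: "compact K" "\<forall>\<^sub>F \<epsilon> in at_right 0. a \<epsilon> \<in> K"
    using a unfolding compactly_supported_nets_def by blast
  have "\<exists>C. \<forall>\<^sub>F \<epsilon> in at_right 0. ?Pr C \<epsilon>"
  proof (rule eventually_compact_localization[OF K])
    fix C C' \<epsilon> :: real assume "C \<le> C'" and Pr: "?Pr C \<epsilon>"
    then have "ennreal (C * \<epsilon> powr m) \<le> ennreal (C' * \<epsilon> powr m)"
      by (intro ennreal_leI mult_right_mono) auto
    with Pr show "?Pr C' \<epsilon>"
      by (meson order_trans)
  next
    fix x assume "x \<in> K"
    obtain V \<phi> where V: "(V, \<phi>) \<in> A" "x \<in> V"
      using chart_around[OF A(1)] .
    obtain R where R: "R > 0" "cball (\<phi> x) R \<subseteq> \<phi> ` V"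
      using chart_cball[OF A(1) V] .
    obtain C where C: "C > 0"
      and up: "\<And>p q. p \<in> V \<Longrightarrow> q \<in> V \<Longrightarrow> \<phi> p \<in> cball (\<phi> x) R \<Longrightarrow> \<phi> q \<in> cball (\<phi> x) R \<Longrightarrow>
        riemannian_dist A h p q \<le> ennreal (C * dist (\<phi> p) (\<phi> q))"
      and low: "\<And>p q r. p \<in> V \<Longrightarrow> riemannian_dist A h p q < ennreal r \<Longrightarrow> dist (\<phi> x) (\<phi> p) + C * r < R \<Longrightarrow>
      q \<in> V \<and> \<phi> q \<in> ball (\<phi> x) R \<and> dist (\<phi> p) (\<phi> q) \<le> C * r"
      using chart_distance_comparison[OF A V(1) R(2)] by metis
    obtain W0 where W0: "open W0" "x \<in> W0" "W0 \<subseteq> V"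
      and cl: "\<forall>m>0. \<exists>C. \<forall>\<^sub>F \<epsilon> in at_right 0.
        a \<epsilon> \<in> W0 \<longrightarrow> b \<epsilon> \<in> V \<and> dist (\<phi> (a \<epsilon>)) (\<phi> (b \<epsilon>)) \<le> C * \<epsilon> powr m"
      using infinitely_closeE[OF close V] .
    obtain D where D: "\<forall>\<^sub>F \<epsilon> in at_right 0.
        a \<epsilon> \<in> W0 \<longrightarrow> b \<epsilon> \<in> V \<and> dist (\<phi> (a \<epsilon>)) (\<phi> (b \<epsilon>)) \<le> D * \<epsilon> powr m"
      using cl m by blast
    define W where "W = W0 \<inter> (V \<inter> \<phi> -` ball (\<phi> x) (R / 2))"
    have W: "open W" "x \<in> W"
      using W0 V R open_chart_preimage[OF A(1) V(1) open_ball] by (auto simp: W_def)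
    have "\<forall>\<^sub>F \<epsilon> in at_right 0. D * \<epsilon> powr m < R / 2"
      using R(1) by (intro eventually_powr_less m) auto
    with D have "\<forall>\<^sub>F \<epsilon> in at_right 0. a \<epsilon> \<in> W \<longrightarrow> ?Pr (C * D) \<epsilon>"
    proof eventually_elim
      case (elim \<epsilon>)
      show ?case
      proof
        assume aW: "a \<epsilon> \<in> W"
        then have b: "a \<epsilon> \<in> V" "b \<epsilon> \<in> V" "dist (\<phi> (a \<epsilon>)) (\<phi> (b \<epsilon>)) \<le> D * \<epsilon> powr m"
          and a2: "dist (\<phi> x) (\<phi> (a \<epsilon>)) < R / 2"
          using elim(1) by (auto simp: W_def)
        have in_ball: "\<phi> (a \<epsilon>) \<in> cball (\<phi> x) R" "\<phi> (b \<epsilon>) \<in> cball (\<phi> x) R"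
          using a2 b(3) elim(2) dist_triangle[of "\<phi> x" "\<phi> (b \<epsilon>)" "\<phi> (a \<epsilon>)"] R(1) by auto
        have le: "ennreal (C * dist (\<phi> (a \<epsilon>)) (\<phi> (b \<epsilon>))) \<le> ennreal (C * D * \<epsilon> powr m)"
          using mult_left_mono[OF b(3), of C] C by (intro ennreal_leI) (simp add: mult_ac)
        show "?Pr (C * D) \<epsilon>"
          using order_trans[OF up[OF b(1,2) in_ball] le]
            order_trans[OF up[OF b(2,1) in_ball(2,1), unfolded dist_commute[of "\<phi> (b \<epsilon>)"]] le]
          by (rule conjI)
      qed
    qed
    with W show "\<exists>W C. open W \<and> x \<in> W \<and> (\<forall>\<^sub>F \<epsilon> in at_right 0. a \<epsilon> \<in> W \<longrightarrow> ?Pr C \<epsilon>)"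
      by blast
  qed
  then obtain C where C: "\<forall>\<^sub>F \<epsilon> in at_right 0. ?Pr C \<epsilon>" ..
  show "bigO_eps (\<lambda>\<epsilon>. riemannian_dist A h (a \<epsilon>) (b \<epsilon>)) m"
    "bigO_eps (\<lambda>\<epsilon>. riemannian_dist A h (b \<epsilon>) (a \<epsilon>)) m"
    unfolding bigO_eps_def by (intro exI[of _ C] eventually_mono[OF C]; simp)+
qed

text \<open>
  Transitivity reduces to the triangle inequality in a chart, once \<open>W\<close> is so small that
  \<open>b \<epsilon>\<close> lies in the neighbourhood that belongs to \<open>b\<close> and \<open>c\<close>. No concatenation
  of curves is needed, and the two relations may come from different metrics.
\<close>

lemma infinitely_close_trans:
  assumes A: "smooth_manifold A" and ab: "infinitely_close A a b" and bc: "infinitely_close A b c"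
  shows "infinitely_close A a c"
  unfolding infinitely_close_def
proof (intro allI impI ballI)
  fix V \<phi> x assume V: "(V, \<phi>) \<in> A" "x \<in> V"
  obtain W1 where W1: "open W1" "x \<in> W1" "W1 \<subseteq> V"
    and cl1: "\<forall>m>0. \<exists>C. \<forall>\<^sub>F \<epsilon> in at_right 0.
      a \<epsilon> \<in> W1 \<longrightarrow> b \<epsilon> \<in> V \<and> dist (\<phi> (a \<epsilon>)) (\<phi> (b \<epsilon>)) \<le> C * \<epsilon> powr m"
    using infinitely_closeE[OF ab V] .
  obtain W2 where W2: "open W2" "x \<in> W2" "W2 \<subseteq> V"
    and cl2: "\<forall>m>0. \<exists>C. \<forall>\<^sub>F \<epsilon> in at_right 0.
      b \<epsilon> \<in> W2 \<longrightarrow> c \<epsilon> \<in> V \<and> dist (\<phi> (b \<epsilon>)) (\<phi> (c \<epsilon>)) \<le> C * \<epsilon> powr m"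
    using infinitely_closeE[OF bc V] .
  have "open (\<phi> ` (V \<inter> W2))" "\<phi> x \<in> \<phi> ` (V \<inter> W2)"
    using open_chart_image[OF A V(1) W2(1)] V(2) W2(2) by auto
  then obtain \<delta> where \<delta>: "\<delta> > 0" "ball (\<phi> x) \<delta> \<subseteq> \<phi> ` (V \<inter> W2)"
    using open_contains_ball by metis
  define W where "W = W1 \<inter> (V \<inter> \<phi> -` ball (\<phi> x) (\<delta> / 2))"
  have "open W" "x \<in> W" "W \<subseteq> V"
    using W1 V \<delta> open_chart_preimage[OF A V(1) open_ball] by (auto simp: W_def)
  moreover have "\<exists>C. \<forall>\<^sub>F \<epsilon> in at_right 0.
      a \<epsilon> \<in> W \<longrightarrow> c \<epsilon> \<in> V \<and> dist (\<phi> (a \<epsilon>)) (\<phi> (c \<epsilon>)) \<le> C * \<epsilon> powr m" if m: "m > 0" for m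
  proof -
    obtain C D where C: "\<forall>\<^sub>F \<epsilon> in at_right 0.
        a \<epsilon> \<in> W1 \<longrightarrow> b \<epsilon> \<in> V \<and> dist (\<phi> (a \<epsilon>)) (\<phi> (b \<epsilon>)) \<le> C * \<epsilon> powr m"
      and D: "\<forall>\<^sub>F \<epsilon> in at_right 0.
        b \<epsilon> \<in> W2 \<longrightarrow> c \<epsilon> \<in> V \<and> dist (\<phi> (b \<epsilon>)) (\<phi> (c \<epsilon>)) \<le> D * \<epsilon> powr m"
      using cl1 cl2 m by meson
    have "\<forall>\<^sub>F \<epsilon> in at_right 0. C * \<epsilon> powr m < \<delta> / 2"
      using \<delta>(1) by (intro eventually_powr_less m) auto
    with C D have "\<forall>\<^sub>F \<epsilon> in at_right 0.
        a \<epsilon> \<in> W \<longrightarrow> c \<epsilon> \<in> V \<and> dist (\<phi> (a \<epsilon>)) (\<phi> (c \<epsilon>)) \<le> (C + D) * \<epsilon> powr m"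
    proof eventually_elim
      case (elim \<epsilon>)
      show ?case
      proof
        assume aW: "a \<epsilon> \<in> W"
        then have b: "b \<epsilon> \<in> V" "dist (\<phi> (a \<epsilon>)) (\<phi> (b \<epsilon>)) \<le> C * \<epsilon> powr m"
          and a2: "dist (\<phi> x) (\<phi> (a \<epsilon>)) < \<delta> / 2"
          using elim(1) by (auto simp: W_def)
        have "\<phi> (b \<epsilon>) \<in> ball (\<phi> x) \<delta>"
          using a2 b(2) elim(3) dist_triangle[of "\<phi> x" "\<phi> (b \<epsilon>)" "\<phi> (a \<epsilon>)"] by auto
        then obtain z where "z \<in> V" "z \<in> W2" "\<phi> (b \<epsilon>) = \<phi> z"
          using \<delta>(2) by auto
        then have "b \<epsilon> \<in> W2"
          using chart_props(5)[OF A V(1)] b(1) by metis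
        then have "c \<epsilon> \<in> V" "dist (\<phi> (b \<epsilon>)) (\<phi> (c \<epsilon>)) \<le> D * \<epsilon> powr m"
          using elim(2) by auto
        then show "c \<epsilon> \<in> V \<and> dist (\<phi> (a \<epsilon>)) (\<phi> (c \<epsilon>)) \<le> (C + D) * \<epsilon> powr m"
          using b(2) dist_triangle[of "\<phi> (a \<epsilon>)" "\<phi> (c \<epsilon>)" "\<phi> (b \<epsilon>)"] by (simp add: distrib_right)
      qed
    qed
    then show ?thesis by blast
  qed
  ultimately show "\<exists>W. open W \<and> x \<in> W \<and> W \<subseteq> V \<and> (\<forall>m>0. \<exists>C. \<forall>\<^sub>F \<epsilon> in at_right 0.
      a \<epsilon> \<in> W \<longrightarrow> c \<epsilon> \<in> V \<and> dist (\<phi> (a \<epsilon>)) (\<phi> (c \<epsilon>)) \<le> C * \<epsilon> powr m)"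
    by blast
qed

text \<open>
  The metric that witnesses the equivalence of two nets can therefore be exchanged for any other,
  which is what makes the relation transitive.
\<close>

lemma point_rel_eq:
  assumes A: "smooth_manifold A"
  shows "(a, b) \<in> point_rel A \<longleftrightarrow> a \<in> compactly_supported_nets \<and> b \<in> compactly_supported_nets \<and>
    (\<exists>h. riemannian_metric A h) \<and> infinitely_close A a b"
proof
  assume "(a, b) \<in> point_rel A"
  then have ab: "a \<in> compactly_supported_nets" "b \<in> compactly_supported_nets"
    and "\<exists>h. riemannian_metric A h \<and> (\<forall>m>0. bigO_eps (\<lambda>\<epsilon>. riemannian_dist A h (a \<epsilon>) (b \<epsilon>)) m)"
    by (auto simp: point_rel_def)
  then obtain h where h: "riemannian_metric A h"
    and d: "\<And>m. m > 0 \<Longrightarrow> bigO_eps (\<lambda>\<epsilon>. riemannian_dist A h (a \<epsilon>) (b \<epsilon>)) m"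
    by blast
  show "a \<in> compactly_supported_nets \<and> b \<in> compactly_supported_nets \<and>
      (\<exists>h. riemannian_metric A h) \<and> infinitely_close A a b"
    using ab h infinitely_close_if_distance_negligible[OF A h d] by blast
next
  assume *: "a \<in> compactly_supported_nets \<and> b \<in> compactly_supported_nets \<and>
    (\<exists>h. riemannian_metric A h) \<and> infinitely_close A a b"
  then obtain h where h: "riemannian_metric A h"
    by blast
  have "\<forall>m>0. bigO_eps (\<lambda>\<epsilon>. riemannian_dist A h (a \<epsilon>) (b \<epsilon>)) m"
    using distance_negligible_if_infinitely_close(1)[OF A h] * by blast
  then show "(a, b) \<in> point_rel A"
    using * h unfolding point_rel_def by blast
qed

lemma point_rel_sym:
  assumes A: "smooth_manifold A"
  shows "sym (point_rel A)"
proof (rule symI)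
  fix a b assume ab: "(a, b) \<in> point_rel A"
  then obtain h where h: "riemannian_metric A h" and cl: "infinitely_close A a b"
    and cs: "a \<in> compactly_supported_nets" "b \<in> compactly_supported_nets"
    using point_rel_eq[OF A] by blast
  have "\<forall>m>0. bigO_eps (\<lambda>\<epsilon>. riemannian_dist A h (b \<epsilon>) (a \<epsilon>)) m"
    using distance_negligible_if_infinitely_close(2)[OF A h cl cs(1)] by blast
  then show "(b, a) \<in> point_rel A"
    using cs h unfolding point_rel_def by blast
qed

lemma point_rel_trans:
  assumes A: "smooth_manifold A"
  shows "trans (point_rel A)"
  using infinitely_close_trans[OF A] by (intro transI) (auto simp: point_rel_eq[OF A])


section \<open>Images under moderate nets\<close>

lemma total_deriv_norm_0: "total_deriv_norm 0 f x = ennreal (norm (f x))"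
proof -
  have "{vs::'a list. length vs = 0 \<and> (\<forall>v\<in>set vs. norm v \<le> 1)} = {[]}"
    by auto
  then show ?thesis
    by (simp add: total_deriv_norm_def)
qed

lemma norm_frechet_derivative_le:
  assumes "total_deriv_norm 1 f x \<le> ennreal M" "0 \<le> M" "f differentiable (at x)"
  shows "norm (frechet_derivative f (at x) v) \<le> M * norm v"
proof -
  let ?D = "frechet_derivative f (at x)"
  have lin: "linear ?D"
    using assms(3) by (rule linear_frechet_derivative)
  have unit: "norm (?D w) \<le> M" if "norm w \<le> 1" for w
  proof -
    have "ennreal (norm (total_deriv f [w] x)) \<le> total_deriv_norm 1 f x"
      unfolding total_deriv_norm_def using that by (intro SUP_upper) auto
    then have "ennreal (norm (?D w)) \<le> ennreal M"
      using assms(1) by simp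
    then show ?thesis
      using assms(2) by (simp add: ennreal_le_iff)
  qed
  show ?thesis
  proof (cases "v = 0")
    case True
    then show ?thesis using lin by (simp add: linear_0)
  next
    case False
    have "?D v = norm v *\<^sub>R ?D (v /\<^sub>R norm v)"
      using False lin by (simp add: linear_scale)
    then have "norm (?D v) = norm v * norm (?D (v /\<^sub>R norm v))"
      by simp
    also have "\<dots> \<le> norm v * M"
      using False by (intro mult_left_mono unit) auto
    finally show ?thesis by (simp add: mult.commute)
  qed
qed

text \<open>
  A mean value inequality in charts. The bound on the derivative is available only at points whose
  image lies in a given compact set, so the image of the segment from \<open>p\<close> to \<open>q\<close> has to be
  kept inside a ball; the trapping lemma does this if the bound keeps the displacement small.
\<close>

lemma chart_image_displacement:
  assumes X: "smooth_manifold X" "(V, \<phi>) \<in> X" "cball x r \<subseteq> \<phi> ` V"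
    and Y: "smooth_manifold Y" "(W, \<psi>) \<in> Y" "cball y R \<subseteq> \<psi> ` W"
    and u: "smooth_map X Y u"
    and M: "0 \<le> M" "\<And>p. p \<in> V \<Longrightarrow> \<phi> p \<in> cball x r \<Longrightarrow> u p \<in> W \<Longrightarrow> \<psi> (u p) \<in> cball y R \<Longrightarrow>
      total_deriv_norm 1 (\<psi> \<circ> u \<circ> inv_into V \<phi>) (\<phi> p) \<le> ennreal M"
    and p: "p \<in> V" "\<phi> p \<in> cball x r" "u p \<in> W" and q: "q \<in> V" "\<phi> q \<in> cball x r"
    and small: "dist y (\<psi> (u p)) + M * dist (\<phi> p) (\<phi> q) < R"
  shows "u q \<in> W \<and> \<psi> (u q) \<in> ball y R \<and> dist (\<psi> (u p)) (\<psi> (u q)) \<le> M * dist (\<phi> p) (\<phi> q)"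
proof -
  note chX = chart_props[OF X(1,2)]
  define w where "w = \<phi> q - \<phi> p"
  let ?l = "\<lambda>t::real. \<phi> p + t *\<^sub>R w"
  define c where "c t = u (inv_into V \<phi> (?l t))" for t
  have seg: "?l t \<in> cball x r" if "t \<in> {0..1}" for t
    using convexD_alt[OF convex_cball p(2) q(2), of t] that by (simp add: w_def algebra_simps)
  have segV: "inv_into V \<phi> (?l t) \<in> V" "\<phi> (inv_into V \<phi> (?l t)) = ?l t" if "t \<in> {0..1}" for t
    using seg[OF that] X(3) chX(6,7) by blast+
  have c01: "c 0 = u p" "c 1 = u q"
    using chX(5) p q by (simp_all add: c_def w_def)
  have "c 1 \<in> W \<and> \<psi> (c 1) \<in> ball y R \<and> dist (\<psi> (c 0)) (\<psi> (c 1)) \<le> M * dist (\<phi> p) (\<phi> q)"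
  proof (rule curve_trapped_in_chart_ball[OF Y])
    have "continuous_on UNIV u"
      using u by (simp add: smooth_map_def)
    moreover have "continuous_on {0..1} (\<lambda>t. inv_into V \<phi> (?l t))"
      by (rule continuous_on_compose2[OF chX(4)])
        (use seg X(3) in \<open>auto intro!: continuous_intros\<close>)
    ultimately show "continuous_on {0..1} c"
      unfolding c_def by (rule continuous_on_compose2) auto
    show "c 0 \<in> W" "0 \<le> M * dist (\<phi> p) (\<phi> q)" "dist y (\<psi> (c 0)) + M * dist (\<phi> p) (\<phi> q) < R"
      using p M(1) small c01 by auto
    fix s :: real assume s: "s \<in> {0..1}"
      and inball: "\<And>t. t \<in> {0..s} \<Longrightarrow> c t \<in> W \<and> \<psi> (c t) \<in> ball y R"
    let ?F = "\<psi> \<circ> u \<circ> inv_into V \<phi>"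
    let ?D = "\<lambda>t. frechet_derivative ?F (at (?l t))"
    have der: "((\<lambda>t. \<psi> (c t)) has_derivative (\<lambda>\<tau>. \<tau> *\<^sub>R ?D t w)) (at t within {0..s})"
      "norm (?D t w) \<le> M * norm w" if t: "t \<in> {0..s}" for t
    proof -
      have t1: "t \<in> {0..1}"
        using t s by auto
      let ?p = "inv_into V \<phi> (?l t)"
      have up: "?p \<in> V" "u ?p \<in> W" "\<psi> (u ?p) \<in> cball y R" "\<phi> ?p = ?l t"
        using segV[OF t1] inball[OF t] by (auto simp: c_def)
      have sm: "smooth_on (\<phi> ` (V \<inter> u -` W)) ?F"
        using u X(2) Y(2) unfolding smooth_map_def by fast
      have "?l t \<in> \<phi> ` (V \<inter> u -` W)"
        using up by (metis IntI imageI vimageI)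
      with sm have diff: "?F differentiable (at (?l t))"
        by (rule smooth_on_differentiable)
      have "total_deriv_norm 1 ?F (?l t) \<le> ennreal M"
        using M(2)[OF up(1) _ up(2,3)] seg[OF t1] up(4) by simp
      then show "norm (?D t w) \<le> M * norm w"
        using M(1) diff by (rule norm_frechet_derivative_le)
      have lin: "linear (?D t)"
        using diff by (rule linear_frechet_derivative)
      have "(?F has_derivative ?D t) (at (?l t))"
        using diff by (simp add: frechet_derivative_works)
      moreover have "(?l has_derivative (\<lambda>\<tau>. \<tau> *\<^sub>R w)) (at t within {0..s})"
        by (auto intro!: derivative_eq_intros)
      ultimately have "((\<lambda>t. ?F (?l t)) has_derivative (\<lambda>\<tau>. ?D t (\<tau> *\<^sub>R w))) (at t within {0..s})"
        by (rule has_derivative_compose[rotated])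
      then show "((\<lambda>t. \<psi> (c t)) has_derivative (\<lambda>\<tau>. \<tau> *\<^sub>R ?D t w)) (at t within {0..s})"
        using lin by (simp add: c_def o_def linear_scale)
    qed
    have on: "onorm (\<lambda>\<tau>::real. \<tau> *\<^sub>R ?D t w) \<le> M * norm w" if "t \<in> {0..s}" for t
      by (rule onorm_le) (use der(2)[OF that] in \<open>simp add: mult.commute mult_left_mono\<close>)
    have "norm (\<psi> (c 0) - \<psi> (c s)) \<le> M * norm w * norm (0 - s)"
      using s by (intro differentiable_bound[OF _ der(1) on]) auto
    also have "\<dots> \<le> M * norm w * 1"
      using s M(1) by (intro mult_left_mono) auto
    finally show "dist (\<psi> (c 0)) (\<psi> (c s)) \<le> M * dist (\<phi> p) (\<phi> q)"
      by (simp add: dist_norm w_def norm_minus_commute)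
  qed
  then show ?thesis
    by (simp add: c01)
qed

lemma chart_ball_preimage_compact:
  assumes A: "smooth_manifold A" "(V, \<phi>) \<in> A" "cball x r \<subseteq> \<phi> ` V"
  shows "compact (inv_into V \<phi> ` cball x r)" and "inv_into V \<phi> ` cball x r \<subseteq> V"
    and "p \<in> V \<Longrightarrow> \<phi> p \<in> cball x r \<Longrightarrow> p \<in> inv_into V \<phi> ` cball x r"
proof -
  note ch = chart_props[OF A(1,2)]
  show "compact (inv_into V \<phi> ` cball x r)"
    by (intro compact_continuous_image continuous_on_subset[OF ch(4) A(3)]
        compact_cball_finite_span model_space_finite_dimensional[OF A(1)])
  show "inv_into V \<phi> ` cball x r \<subseteq> V"
    using ch(7) A(3) by blast
  show "p \<in> V \<Longrightarrow> \<phi> p \<in> cball x r \<Longrightarrow> p \<in> inv_into V \<phi> ` cball x r"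
    using ch(5) by (metis imageI)
qed

text \<open>
  Of the derivatives, order \<open>1\<close> is the one that enters the mean value inequality.
\<close>

lemma moderate_netsD:
  assumes "u \<in> moderate_nets X Y"
  shows "\<epsilon> \<in> {0<..1} \<Longrightarrow> smooth_map X Y (u \<epsilon>)"
    and "compact K \<Longrightarrow> \<exists>K'. compact K' \<and> (\<forall>\<^sub>F \<epsilon> in at_right 0. u \<epsilon> ` K \<subseteq> K')"
    and "(V, \<phi>) \<in> X \<Longrightarrow> (W, \<psi>) \<in> Y \<Longrightarrow> compact L \<Longrightarrow> L \<subseteq> V \<Longrightarrow> compact L' \<Longrightarrow> L' \<subseteq> W \<Longrightarrow>
      \<exists>N::nat. bigO_eps (\<lambda>\<epsilon>. SUP p\<in>L \<inter> u \<epsilon> -` L'.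
        total_deriv_norm 1 (\<psi> \<circ> u \<epsilon> \<circ> inv_into V \<phi>) (\<phi> p)) (- real N)"
proof -
  have 1: "\<forall>\<epsilon>\<in>{0<..1}. smooth_map X Y (u \<epsilon>)"
    and 2: "\<forall>K. compact K \<longrightarrow> (\<exists>K'. compact K' \<and> (\<forall>\<^sub>F \<epsilon> in at_right 0. u \<epsilon> ` K \<subseteq> K'))"
    and 3: "\<forall>k::nat. k \<ge> 1 \<longrightarrow> (\<forall>(V, \<phi>)\<in>X. \<forall>(W, \<psi>)\<in>Y. \<forall>L L'.
        compact L \<and> L \<subseteq> V \<and> compact L' \<and> L' \<subseteq> W \<longrightarrow>
        (\<exists>N::nat. N \<ge> 1 \<and>
           bigO_eps (\<lambda>\<epsilon>. SUP p\<in>L \<inter> u \<epsilon> -` L'.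
             total_deriv_norm k (\<psi> \<circ> u \<epsilon> \<circ> inv_into V \<phi>) (\<phi> p)) (- real N)))"
    using assms unfolding moderate_nets_def mem_Collect_eq by - (elim conjE, assumption)+
  show "\<epsilon> \<in> {0<..1} \<Longrightarrow> smooth_map X Y (u \<epsilon>)"
    using 1 by blast
  show "compact K \<Longrightarrow> \<exists>K'. compact K' \<and> (\<forall>\<^sub>F \<epsilon> in at_right 0. u \<epsilon> ` K \<subseteq> K')"
    using 2 by blast
  assume V: "(V, \<phi>) \<in> X" and W: "(W, \<psi>) \<in> Y" and L: "compact L" "L \<subseteq> V" "compact L'" "L' \<subseteq> W"
  have "\<forall>(V, \<phi>)\<in>X. \<forall>(W, \<psi>)\<in>Y. \<forall>L L'. compact L \<and> L \<subseteq> V \<and> compact L' \<and> L' \<subseteq> W \<longrightarrow>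
      (\<exists>N::nat. N \<ge> 1 \<and> bigO_eps (\<lambda>\<epsilon>. SUP p\<in>L \<inter> u \<epsilon> -` L'.
         total_deriv_norm 1 (\<psi> \<circ> u \<epsilon> \<circ> inv_into V \<phi>) (\<phi> p)) (- real N))"
    using 3 by simp
  from bspec[OF bspec[OF this V, unfolded prod.case] W, unfolded prod.case] L
  show "\<exists>N::nat. bigO_eps (\<lambda>\<epsilon>. SUP p\<in>L \<inter> u \<epsilon> -` L'.
        total_deriv_norm 1 (\<psi> \<circ> u \<epsilon> \<circ> inv_into V \<phi>) (\<phi> p)) (- real N)"
    by blast
qed

lemma moderate_net_compactly_supported:
  assumes "u \<in> moderate_nets X Y" "a \<in> compactly_supported_nets"
  shows "(\<lambda>\<epsilon>. u \<epsilon> (a \<epsilon>)) \<in> compactly_supported_nets"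
proof -
  obtain K where K: "compact K" "\<forall>\<^sub>F \<epsilon> in at_right 0. a \<epsilon> \<in> K"
    using assms(2) unfolding compactly_supported_nets_def by blast
  obtain K' where K': "compact K'" "\<forall>\<^sub>F \<epsilon> in at_right 0. u \<epsilon> ` K \<subseteq> K'"
    using moderate_netsD(2)[OF assms(1) K(1)] by blast
  have "\<forall>\<^sub>F \<epsilon> in at_right 0. u \<epsilon> (a \<epsilon>) \<in> K'"
    using K(2) K'(2) by eventually_elim blast
  then show ?thesis
    using K'(1) unfolding compactly_supported_nets_def by blast
qed

text \<open>
  A moderate net expands distances in charts at most by a factor \<open>O(\<epsilon>\<^sup>-\<^sup>N)\<close>. As the distance of
  \<open>a\<close> and \<open>b\<close> is \<open>O(\<epsilon>\<^sup>m\<^sup>+\<^sup>N)\<close>, that of their images is \<open>O(\<epsilon>\<^sup>m)\<close>. The same product tends to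
  \<open>0\<close>, which is the smallness that traps the image of the segment.
\<close>

lemma infinitely_close_moderate_image:
  assumes X: "smooth_manifold X" and Y: "smooth_manifold Y"
    and u: "u \<in> moderate_nets X Y" and a: "a \<in> compactly_supported_nets"
    and close: "infinitely_close X a b"
  shows "infinitely_close Y (\<lambda>\<epsilon>. u \<epsilon> (a \<epsilon>)) (\<lambda>\<epsilon>. u \<epsilon> (b \<epsilon>))"
  unfolding infinitely_close_def
proof (intro allI impI ballI)
  fix W \<psi> y assume W: "(W, \<psi>) \<in> Y" "y \<in> W"
  obtain K where K: "compact K" "\<forall>\<^sub>F \<epsilon> in at_right 0. a \<epsilon> \<in> K"
    using a unfolding compactly_supported_nets_def by blast
  obtain R where R: "R > 0" "cball (\<psi> y) R \<subseteq> \<psi> ` W"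
    using chart_cball[OF Y W] .
  define G where "G = W \<inter> \<psi> -` ball (\<psi> y) (R / 2)"
  have "open G" "y \<in> G" "G \<subseteq> W"
    using open_chart_preimage[OF Y W(1) open_ball] W R by (auto simp: G_def)
  moreover have "\<exists>C. \<forall>\<^sub>F \<epsilon> in at_right 0. u \<epsilon> (a \<epsilon>) \<in> G \<longrightarrow>
      u \<epsilon> (b \<epsilon>) \<in> W \<and> dist (\<psi> (u \<epsilon> (a \<epsilon>))) (\<psi> (u \<epsilon> (b \<epsilon>))) \<le> C * \<epsilon> powr m" if m: "m > 0" for m
  proof (rule eventually_compact_localization[OF K])
    fix C C' \<epsilon> :: real
    assume C: "C \<le> C'" and *: "u \<epsilon> (a \<epsilon>) \<in> G \<longrightarrow>
      u \<epsilon> (b \<epsilon>) \<in> W \<and> dist (\<psi> (u \<epsilon> (a \<epsilon>))) (\<psi> (u \<epsilon> (b \<epsilon>))) \<le> C * \<epsilon> powr m"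
    have "C * \<epsilon> powr m \<le> C' * \<epsilon> powr m"
      using C by (rule mult_right_mono) simp
    then show "u \<epsilon> (a \<epsilon>) \<in> G \<longrightarrow>
      u \<epsilon> (b \<epsilon>) \<in> W \<and> dist (\<psi> (u \<epsilon> (a \<epsilon>))) (\<psi> (u \<epsilon> (b \<epsilon>))) \<le> C' * \<epsilon> powr m"
      using * by auto
  next
    fix x assume "x \<in> K"
    obtain V \<phi> where V: "(V, \<phi>) \<in> X" "x \<in> V"
      using chart_around[OF X] .
    obtain r where r: "r > 0" "cball (\<phi> x) r \<subseteq> \<phi> ` V"
      using chart_cball[OF X V] .
    obtain V0 where V0: "open V0" "x \<in> V0" "V0 \<subseteq> V"
      and cl: "\<forall>m>0. \<exists>C. \<forall>\<^sub>F \<epsilon> in at_right 0.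
        a \<epsilon> \<in> V0 \<longrightarrow> b \<epsilon> \<in> V \<and> dist (\<phi> (a \<epsilon>)) (\<phi> (b \<epsilon>)) \<le> C * \<epsilon> powr m"
      using infinitely_closeE[OF close V] .
    let ?L = "inv_into V \<phi> ` cball (\<phi> x) r" and ?L' = "inv_into W \<psi> ` cball (\<psi> y) R"
    note L = chart_ball_preimage_compact[OF X V(1) r(2)]
    note L' = chart_ball_preimage_compact[OF Y W(1) R(2)]
    obtain N :: nat where "bigO_eps (\<lambda>\<epsilon>. SUP p\<in>?L \<inter> u \<epsilon> -` ?L'.
        total_deriv_norm 1 (\<psi> \<circ> u \<epsilon> \<circ> inv_into V \<phi>) (\<phi> p)) (- real N)"
      using moderate_netsD(3)[OF u V(1) W(1) L(1,2) L'(1,2)] by blast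
    then obtain B where B: "\<forall>\<^sub>F \<epsilon> in at_right 0. (SUP p\<in>?L \<inter> u \<epsilon> -` ?L'.
        total_deriv_norm 1 (\<psi> \<circ> u \<epsilon> \<circ> inv_into V \<phi>) (\<phi> p)) \<le> ennreal (B * \<epsilon> powr (- real N))"
      unfolding bigO_eps_def by blast
    have mN: "m + real N > 0"
      using m by simp
    obtain D where D: "\<forall>\<^sub>F \<epsilon> in at_right 0.
        a \<epsilon> \<in> V0 \<longrightarrow> b \<epsilon> \<in> V \<and> dist (\<phi> (a \<epsilon>)) (\<phi> (b \<epsilon>)) \<le> D * \<epsilon> powr (m + real N)"
      using cl mN by blast
    have r2: "\<forall>\<^sub>F \<epsilon> in at_right 0. D * \<epsilon> powr (m + real N) < r / 2"
      using r(1) by (intro eventually_powr_less mN) auto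
    have R2: "\<forall>\<^sub>F \<epsilon> in at_right 0. (\<bar>B\<bar> * D) * \<epsilon> powr m < R / 2"
      using R(1) by (intro eventually_powr_less m) auto
    have le1: "\<forall>\<^sub>F \<epsilon> in at_right 0. \<epsilon> \<in> {0<..1::real}"
      using eventually_at_right_real[of 0 1] by (auto elim: eventually_mono)
    define H where "H = V0 \<inter> (V \<inter> \<phi> -` ball (\<phi> x) (r / 2))"
    have H: "open H" "x \<in> H"
      using V0 V r open_chart_preimage[OF X V(1) open_ball] by (auto simp: H_def)
    from B D r2 R2 le1 have "\<forall>\<^sub>F \<epsilon> in at_right 0. a \<epsilon> \<in> H \<longrightarrow> u \<epsilon> (a \<epsilon>) \<in> G \<longrightarrow>
      u \<epsilon> (b \<epsilon>) \<in> W \<and> dist (\<psi> (u \<epsilon> (a \<epsilon>))) (\<psi> (u \<epsilon> (b \<epsilon>))) \<le> (\<bar>B\<bar> * D) * \<epsilon> powr m"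
    proof eventually_elim
      case (elim \<epsilon>)
      show ?case
      proof (intro impI)
        assume aH: "a \<epsilon> \<in> H" and uG: "u \<epsilon> (a \<epsilon>) \<in> G"
        let ?M = "\<bar>B\<bar> * \<epsilon> powr (- real N)"
        have b: "a \<epsilon> \<in> V" "b \<epsilon> \<in> V" "dist (\<phi> (a \<epsilon>)) (\<phi> (b \<epsilon>)) \<le> D * \<epsilon> powr (m + real N)"
          and a2: "dist (\<phi> x) (\<phi> (a \<epsilon>)) < r / 2"
          using aH elim(2) by (auto simp: H_def)
        have in_ball: "\<phi> (a \<epsilon>) \<in> cball (\<phi> x) r" "\<phi> (b \<epsilon>) \<in> cball (\<phi> x) r"
          using a2 b(3) elim(3) dist_triangle[of "\<phi> x" "\<phi> (b \<epsilon>)" "\<phi> (a \<epsilon>)"] r(1) by auto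
        have ua: "u \<epsilon> (a \<epsilon>) \<in> W" "dist (\<psi> y) (\<psi> (u \<epsilon> (a \<epsilon>))) < R / 2"
          using uG by (auto simp: G_def)
        have "?M * dist (\<phi> (a \<epsilon>)) (\<phi> (b \<epsilon>)) \<le> ?M * (D * \<epsilon> powr (m + real N))"
          by (rule mult_left_mono[OF b(3)]) simp
        also have "\<dots> = (\<bar>B\<bar> * D) * \<epsilon> powr m"
          by (simp add: powr_add[symmetric] mult_ac flip: powr_add)
        finally have Md: "?M * dist (\<phi> (a \<epsilon>)) (\<phi> (b \<epsilon>)) \<le> (\<bar>B\<bar> * D) * \<epsilon> powr m" .
        have "u \<epsilon> (b \<epsilon>) \<in> W \<and> \<psi> (u \<epsilon> (b \<epsilon>)) \<in> ball (\<psi> y) R \<and>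
            dist (\<psi> (u \<epsilon> (a \<epsilon>))) (\<psi> (u \<epsilon> (b \<epsilon>))) \<le> ?M * dist (\<phi> (a \<epsilon>)) (\<phi> (b \<epsilon>))"
        proof (rule chart_image_displacement[OF X V(1) r(2) Y W(1) R(2)])
          show "smooth_map X Y (u \<epsilon>)"
            using moderate_netsD(1)[OF u elim(5)] .
          show "dist (\<psi> y) (\<psi> (u \<epsilon> (a \<epsilon>))) + ?M * dist (\<phi> (a \<epsilon>)) (\<phi> (b \<epsilon>)) < R"
            using ua(2) Md elim(4) by simp
          fix p assume p: "p \<in> V" "\<phi> p \<in> cball (\<phi> x) r" "u \<epsilon> p \<in> W" "\<psi> (u \<epsilon> p) \<in> cball (\<psi> y) R"
          then have "p \<in> ?L \<inter> u \<epsilon> -` ?L'"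
            using L(3) L'(3) by blast
          then have "total_deriv_norm 1 (\<psi> \<circ> u \<epsilon> \<circ> inv_into V \<phi>) (\<phi> p) \<le> (SUP p\<in>?L \<inter> u \<epsilon> -` ?L'.
              total_deriv_norm 1 (\<psi> \<circ> u \<epsilon> \<circ> inv_into V \<phi>) (\<phi> p))"
            by (rule SUP_upper)
          also have "\<dots> \<le> ennreal (B * \<epsilon> powr (- real N))"
            using elim(1) .
          also have "\<dots> \<le> ennreal ?M"
            by (intro ennreal_leI mult_right_mono) auto
          finally show "total_deriv_norm 1 (\<psi> \<circ> u \<epsilon> \<circ> inv_into V \<phi>) (\<phi> p) \<le> ennreal ?M" .
        qed (use b in_ball ua in auto)
        then show "u \<epsilon> (b \<epsilon>) \<in> W \<and>
            dist (\<psi> (u \<epsilon> (a \<epsilon>))) (\<psi> (u \<epsilon> (b \<epsilon>))) \<le> (\<bar>B\<bar> * D) * \<epsilon> powr m"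
          using Md by auto
      qed
    qed
    with H show "\<exists>H C. open H \<and> x \<in> H \<and> (\<forall>\<^sub>F \<epsilon> in at_right 0. a \<epsilon> \<in> H \<longrightarrow> u \<epsilon> (a \<epsilon>) \<in> G \<longrightarrow>
      u \<epsilon> (b \<epsilon>) \<in> W \<and> dist (\<psi> (u \<epsilon> (a \<epsilon>))) (\<psi> (u \<epsilon> (b \<epsilon>))) \<le> C * \<epsilon> powr m)"
      by blast
  qed
  ultimately show "\<exists>G. open G \<and> y \<in> G \<and> G \<subseteq> W \<and> (\<forall>m>0. \<exists>C. \<forall>\<^sub>F \<epsilon> in at_right 0.
      u \<epsilon> (a \<epsilon>) \<in> G \<longrightarrow> u \<epsilon> (b \<epsilon>) \<in> W \<and>
      dist (\<psi> (u \<epsilon> (a \<epsilon>))) (\<psi> (u \<epsilon> (b \<epsilon>))) \<le> C * \<epsilon> powr m)"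
    by blast
qed


section \<open>Equivalent nets and the value at a generalized point\<close>

lemma gf_relD:
  assumes "(u, v) \<in> gf_rel X Y"
  shows "u \<in> moderate_nets X Y" and "v \<in> moderate_nets X Y"
    and "\<exists>h. riemannian_metric Y h \<and> (\<forall>K. compact K \<longrightarrow>
      ((\<lambda>\<epsilon>. SUP p\<in>K. riemannian_dist Y h (u \<epsilon> p) (v \<epsilon> p)) \<longlongrightarrow> 0) (at_right 0))"
    and "m \<ge> 1 \<Longrightarrow> (V, \<phi>) \<in> X \<Longrightarrow> (W, \<psi>) \<in> Y \<Longrightarrow>
      compact L \<Longrightarrow> L \<subseteq> V \<Longrightarrow> compact L' \<Longrightarrow> L' \<subseteq> W \<Longrightarrow>
      bigO_eps (\<lambda>\<epsilon>. SUP p\<in>L \<inter> u \<epsilon> -` L' \<inter> v \<epsilon> -` L'.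
        total_deriv_norm 0 (\<lambda>x. (\<psi> \<circ> u \<epsilon> \<circ> inv_into V \<phi>) x - (\<psi> \<circ> v \<epsilon> \<circ> inv_into V \<phi>) x) (\<phi> p)) (real m)"
proof -
  show "u \<in> moderate_nets X Y" "v \<in> moderate_nets X Y"
    "\<exists>h. riemannian_metric Y h \<and> (\<forall>K. compact K \<longrightarrow>
      ((\<lambda>\<epsilon>. SUP p\<in>K. riemannian_dist Y h (u \<epsilon> p) (v \<epsilon> p)) \<longlongrightarrow> 0) (at_right 0))"
    using assms unfolding gf_rel_def mem_Collect_eq prod.case by - (elim conjE, assumption)+
  have derivs: "\<forall>(k::nat) m::nat. m \<ge> 1 \<longrightarrow> (\<forall>(V, \<phi>)\<in>X. \<forall>(W, \<psi>)\<in>Y. \<forall>L L'.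
        compact L \<and> L \<subseteq> V \<and> compact L' \<and> L' \<subseteq> W \<longrightarrow>
        bigO_eps (\<lambda>\<epsilon>. SUP p\<in>L \<inter> u \<epsilon> -` L' \<inter> v \<epsilon> -` L'.
          total_deriv_norm k
            (\<lambda>x. (\<psi> \<circ> u \<epsilon> \<circ> inv_into V \<phi>) x - (\<psi> \<circ> v \<epsilon> \<circ> inv_into V \<phi>) x) (\<phi> p)) (real m))"
    using assms unfolding gf_rel_def mem_Collect_eq prod.case by - (elim conjE, assumption)
  assume m: "m \<ge> 1" and V: "(V, \<phi>) \<in> X" and W: "(W, \<psi>) \<in> Y"
    and L: "compact L" "L \<subseteq> V" "compact L'" "L' \<subseteq> W"
  from bspec[OF bspec[OF mp[OF spec[OF spec[OF derivs, of 0]] m] V, unfolded prod.case] W,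
      unfolded prod.case] L
  show "bigO_eps (\<lambda>\<epsilon>. SUP p\<in>L \<inter> u \<epsilon> -` L' \<inter> v \<epsilon> -` L'.
      total_deriv_norm 0 (\<lambda>x. (\<psi> \<circ> u \<epsilon> \<circ> inv_into V \<phi>) x - (\<psi> \<circ> v \<epsilon> \<circ> inv_into V \<phi>) x) (\<phi> p)) (real m)"
    by blast
qed

text \<open>
  The zeroth order estimate in the definition of the equivalence holds only at points where both
  images lie in the same chart. That \<open>u\<close> and \<open>v\<close> converge to each other uniformly on
  compact sets guarantees this: once the distance is small, \<open>v \<epsilon> (a \<epsilon>)\<close> lies in a
  larger chart ball than \<open>u \<epsilon> (a \<epsilon>)\<close>.
\<close>

lemma infinitely_close_equivalent_nets:
  assumes X: "smooth_manifold X" and Y: "smooth_manifold Y"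
    and uv: "(u, v) \<in> gf_rel X Y" and a: "a \<in> compactly_supported_nets"
  shows "infinitely_close Y (\<lambda>\<epsilon>. u \<epsilon> (a \<epsilon>)) (\<lambda>\<epsilon>. v \<epsilon> (a \<epsilon>))"
  unfolding infinitely_close_def
proof (intro allI impI ballI)
  fix W \<psi> y assume W: "(W, \<psi>) \<in> Y" "y \<in> W"
  obtain h where h: "riemannian_metric Y h"
    and d0: "\<forall>K. compact K \<longrightarrow>
      ((\<lambda>\<epsilon>. SUP p\<in>K. riemannian_dist Y h (u \<epsilon> p) (v \<epsilon> p)) \<longlongrightarrow> 0) (at_right 0)"
    using gf_relD(3)[OF uv] by (elim exE conjE)
  obtain K where K: "compact K" "\<forall>\<^sub>F \<epsilon> in at_right 0. a \<epsilon> \<in> K"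
    using a unfolding compactly_supported_nets_def by blast
  obtain R where R: "R > 0" "cball (\<psi> y) R \<subseteq> \<psi> ` W"
    using chart_cball[OF Y W] .
  obtain C where C: "C > 0"
    and low: "\<And>p q r. p \<in> W \<Longrightarrow> riemannian_dist Y h p q < ennreal r \<Longrightarrow> dist (\<psi> y) (\<psi> p) + C * r < R \<Longrightarrow>
      q \<in> W \<and> \<psi> q \<in> ball (\<psi> y) R \<and> dist (\<psi> p) (\<psi> q) \<le> C * r"
    using chart_distance_comparison[OF Y h W(1) R(2)] by metis
  define G where "G = W \<inter> \<psi> -` ball (\<psi> y) (R / 2)"
  have "open G" "y \<in> G" "G \<subseteq> W"
    using open_chart_preimage[OF Y W(1) open_ball] W R by (auto simp: G_def)
  moreover
  have "\<forall>\<^sub>F \<epsilon> in at_right 0. (SUP p\<in>K. riemannian_dist Y h (u \<epsilon> p) (v \<epsilon> p)) < ennreal (R / (2 * C))"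
    using R(1) C by (intro order_tendstoD(2)[OF d0[rule_format, OF K(1)]]) simp
  with K(2) have near: "\<forall>\<^sub>F \<epsilon> in at_right 0. u \<epsilon> (a \<epsilon>) \<in> G \<longrightarrow>
      v \<epsilon> (a \<epsilon>) \<in> W \<and> \<psi> (v \<epsilon> (a \<epsilon>)) \<in> ball (\<psi> y) R"
  proof eventually_elim
    case (elim \<epsilon>)
    have "riemannian_dist Y h (u \<epsilon> (a \<epsilon>)) (v \<epsilon> (a \<epsilon>)) \<le> (SUP p\<in>K. riemannian_dist Y h (u \<epsilon> p) (v \<epsilon> p))"
      using elim(1) by (rule SUP_upper)
    then have "riemannian_dist Y h (u \<epsilon> (a \<epsilon>)) (v \<epsilon> (a \<epsilon>)) < ennreal (R / (2 * C))"
      using elim(2) by (rule le_less_trans)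
    moreover have "C * (R / (2 * C)) = R / 2"
      using C by simp
    ultimately show ?case
      using low[of "u \<epsilon> (a \<epsilon>)" "v \<epsilon> (a \<epsilon>)" "R / (2 * C)"] by (auto simp: G_def)
  qed
  have "\<exists>C. \<forall>\<^sub>F \<epsilon> in at_right 0. u \<epsilon> (a \<epsilon>) \<in> G \<longrightarrow>
      v \<epsilon> (a \<epsilon>) \<in> W \<and> dist (\<psi> (u \<epsilon> (a \<epsilon>))) (\<psi> (v \<epsilon> (a \<epsilon>))) \<le> C * \<epsilon> powr m" if m: "m > 0" for m
  proof (rule eventually_compact_localization[OF K])
    fix C C' \<epsilon> :: real
    assume C: "C \<le> C'" and *: "u \<epsilon> (a \<epsilon>) \<in> G \<longrightarrow>
      v \<epsilon> (a \<epsilon>) \<in> W \<and> dist (\<psi> (u \<epsilon> (a \<epsilon>))) (\<psi> (v \<epsilon> (a \<epsilon>))) \<le> C * \<epsilon> powr m"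
    have "C * \<epsilon> powr m \<le> C' * \<epsilon> powr m"
      using C by (rule mult_right_mono) simp
    then show "u \<epsilon> (a \<epsilon>) \<in> G \<longrightarrow>
      v \<epsilon> (a \<epsilon>) \<in> W \<and> dist (\<psi> (u \<epsilon> (a \<epsilon>))) (\<psi> (v \<epsilon> (a \<epsilon>))) \<le> C' * \<epsilon> powr m"
      using * by auto
  next
    fix x assume "x \<in> K"
    obtain V \<phi> where V: "(V, \<phi>) \<in> X" "x \<in> V"
      using chart_around[OF X] .
    obtain r where r: "r > 0" "cball (\<phi> x) r \<subseteq> \<phi> ` V"
      using chart_cball[OF X V] .
    let ?L = "inv_into V \<phi> ` cball (\<phi> x) r" and ?L' = "inv_into W \<psi> ` cball (\<psi> y) R"
    note L = chart_ball_preimage_compact[OF X V(1) r(2)]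
    note L' = chart_ball_preimage_compact[OF Y W(1) R(2)]
    let ?f = "\<lambda>\<epsilon> x. (\<psi> \<circ> u \<epsilon> \<circ> inv_into V \<phi>) x - (\<psi> \<circ> v \<epsilon> \<circ> inv_into V \<phi>) x"
    \<comment> \<open>The hypothesis on \<open>u\<close> and \<open>v\<close> speaks of integer exponents only.\<close>
    define n where "n = nat \<lceil>m\<rceil>"
    have n: "n \<ge> 1" "m \<le> real n"
      using m unfolding n_def by linarith+
    obtain B where B: "\<forall>\<^sub>F \<epsilon> in at_right 0.
        (SUP p\<in>?L \<inter> u \<epsilon> -` ?L' \<inter> v \<epsilon> -` ?L'. total_deriv_norm 0 (?f \<epsilon>) (\<phi> p)) \<le> ennreal (B * \<epsilon> powr real n)"
      using gf_relD(4)[OF uv n(1) V(1) W(1) L(1,2) L'(1,2)] unfolding bigO_eps_def by blast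
    have le1: "\<forall>\<^sub>F \<epsilon> in at_right 0. \<epsilon> \<in> {0<..<1::real}"
      using eventually_at_right_real[of 0 1] by simp
    define H where "H = V \<inter> \<phi> -` ball (\<phi> x) r"
    have H: "open H" "x \<in> H"
      using V r open_chart_preimage[OF X V(1) open_ball] by (auto simp: H_def)
    from B near le1 have "\<forall>\<^sub>F \<epsilon> in at_right 0. a \<epsilon> \<in> H \<longrightarrow> u \<epsilon> (a \<epsilon>) \<in> G \<longrightarrow>
      v \<epsilon> (a \<epsilon>) \<in> W \<and> dist (\<psi> (u \<epsilon> (a \<epsilon>))) (\<psi> (v \<epsilon> (a \<epsilon>))) \<le> \<bar>B\<bar> * \<epsilon> powr m"
    proof eventually_elim
      case (elim \<epsilon>)
      show ?case
      proof (intro impI)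
        assume aH: "a \<epsilon> \<in> H" and uG: "u \<epsilon> (a \<epsilon>) \<in> G"
        have v: "v \<epsilon> (a \<epsilon>) \<in> W" "\<psi> (v \<epsilon> (a \<epsilon>)) \<in> cball (\<psi> y) R"
          using elim(2) uG by auto
        have ua: "u \<epsilon> (a \<epsilon>) \<in> W" "\<psi> (u \<epsilon> (a \<epsilon>)) \<in> cball (\<psi> y) R"
          using uG R(1) by (auto simp: G_def)
        have aV: "a \<epsilon> \<in> V" "\<phi> (a \<epsilon>) \<in> cball (\<phi> x) r"
          using aH by (auto simp: H_def)
        have "a \<epsilon> \<in> ?L \<inter> u \<epsilon> -` ?L' \<inter> v \<epsilon> -` ?L'"
          using L(3)[OF aV] L'(3)[OF ua] L'(3)[OF v] by blast
        then have "total_deriv_norm 0 (?f \<epsilon>) (\<phi> (a \<epsilon>)) \<le>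
            (SUP p\<in>?L \<inter> u \<epsilon> -` ?L' \<inter> v \<epsilon> -` ?L'. total_deriv_norm 0 (?f \<epsilon>) (\<phi> p))"
          by (rule SUP_upper)
        also have "\<dots> \<le> ennreal (B * \<epsilon> powr real n)"
          using elim(1) .
        also have "\<dots> \<le> ennreal (\<bar>B\<bar> * \<epsilon> powr m)"
          using elim(3) n(2) by (intro ennreal_leI mult_mono powr_mono') auto
        finally have "ennreal (dist (\<psi> (u \<epsilon> (a \<epsilon>))) (\<psi> (v \<epsilon> (a \<epsilon>)))) \<le> ennreal (\<bar>B\<bar> * \<epsilon> powr m)"
          using chart_props(5)[OF X V(1) aV(1)] by (simp add: total_deriv_norm_0 dist_norm)
        then show "v \<epsilon> (a \<epsilon>) \<in> W \<and> dist (\<psi> (u \<epsilon> (a \<epsilon>))) (\<psi> (v \<epsilon> (a \<epsilon>))) \<le> \<bar>B\<bar> * \<epsilon> powr m"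
          using v(1) by (simp add: ennreal_le_iff)
      qed
    qed
    with H show "\<exists>H C. open H \<and> x \<in> H \<and> (\<forall>\<^sub>F \<epsilon> in at_right 0. a \<epsilon> \<in> H \<longrightarrow> u \<epsilon> (a \<epsilon>) \<in> G \<longrightarrow>
      v \<epsilon> (a \<epsilon>) \<in> W \<and> dist (\<psi> (u \<epsilon> (a \<epsilon>))) (\<psi> (v \<epsilon> (a \<epsilon>))) \<le> C * \<epsilon> powr m)"
      by blast
  qed
  ultimately show "\<exists>G. open G \<and> y \<in> G \<and> G \<subseteq> W \<and> (\<forall>m>0. \<exists>C. \<forall>\<^sub>F \<epsilon> in at_right 0.
      u \<epsilon> (a \<epsilon>) \<in> G \<longrightarrow> v \<epsilon> (a \<epsilon>) \<in> W \<and>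
      dist (\<psi> (u \<epsilon> (a \<epsilon>))) (\<psi> (v \<epsilon> (a \<epsilon>))) \<le> C * \<epsilon> powr m)"
    by blast
qed

theorem proposition2p13:
  fixes X :: "('a::t2_space, 'e::real_inner) atlas"
    and Y :: "('b::t2_space, 'f::real_inner) atlas"
    and u :: "(real \<Rightarrow> 'a \<Rightarrow> 'b) set" and U :: "real \<Rightarrow> 'a \<Rightarrow> 'b"
    and p :: "(real \<Rightarrow> 'a) set" and P :: "real \<Rightarrow> 'a"
  assumes "smooth_manifold X" and "smooth_manifold Y"
    and "u \<in> generalized_functions X Y" and "U \<in> moderate_nets X Y" and "u = gf_class X Y U"
    and "p \<in> generalized_points X" and "P \<in> compactly_supported_nets" and "p = point_class X P"
  shows "(\<lambda>\<epsilon>. U \<epsilon> (P \<epsilon>)) \<in> compactly_supported_nets \<and>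
    point_class Y (\<lambda>\<epsilon>. U \<epsilon> (P \<epsilon>)) \<in> generalized_points Y \<and>
    (\<forall>V\<in>u. \<forall>Q\<in>p.
       (\<lambda>\<epsilon>. V \<epsilon> (Q \<epsilon>)) \<in> compactly_supported_nets \<and>
       point_class Y (\<lambda>\<epsilon>. V \<epsilon> (Q \<epsilon>)) = point_class Y (\<lambda>\<epsilon>. U \<epsilon> (P \<epsilon>)))"
proof (intro conjI ballI)
  note X = assms(1) and Y = assms(2) and U = assms(4) and P = assms(7)
  show UP: "(\<lambda>\<epsilon>. U \<epsilon> (P \<epsilon>)) \<in> compactly_supported_nets"
    using U P by (rule moderate_net_compactly_supported)
  then show "point_class Y (\<lambda>\<epsilon>. U \<epsilon> (P \<epsilon>)) \<in> generalized_points Y"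
    unfolding point_class_def generalized_points_def by (rule quotientI)
  fix V Q assume "V \<in> u" "Q \<in> p"
  then have UV: "(U, V) \<in> gf_rel X Y" and PQ: "(P, Q) \<in> point_rel X"
    using assms(5,8) by (simp_all add: gf_class_def point_class_def)
  have V: "V \<in> moderate_nets X Y"
    using UV by (rule gf_relD)
  obtain h where h: "riemannian_metric Y h"
    using gf_relD(3)[OF UV] by blast
  have Q: "Q \<in> compactly_supported_nets" and close: "infinitely_close X P Q"
    using PQ point_rel_eq[OF X] by blast+
  show VQ: "(\<lambda>\<epsilon>. V \<epsilon> (Q \<epsilon>)) \<in> compactly_supported_nets"
    using V Q by (rule moderate_net_compactly_supported)
  have "infinitely_close Y (\<lambda>\<epsilon>. U \<epsilon> (P \<epsilon>)) (\<lambda>\<epsilon>. V \<epsilon> (Q \<epsilon>))"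
    using infinitely_close_moderate_image[OF X Y U P close]
      infinitely_close_equivalent_nets[OF X Y UV Q]
    by (rule infinitely_close_trans[OF Y])
  then have "((\<lambda>\<epsilon>. U \<epsilon> (P \<epsilon>)), (\<lambda>\<epsilon>. V \<epsilon> (Q \<epsilon>))) \<in> point_rel Y"
    using UP VQ h point_rel_eq[OF Y] by blast
  then show "point_class Y (\<lambda>\<epsilon>. V \<epsilon> (Q \<epsilon>)) = point_class Y (\<lambda>\<epsilon>. U \<epsilon> (P \<epsilon>))"
    using point_rel_sym[OF Y] point_rel_trans[OF Y]
    unfolding point_class_def by (blast dest: symD transD)
qed

end
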